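(* Let $h\in\mathcal Z_+'$ be real, let $b\in C_0^\infty(\mathbb R)'$ be its $b$-function and $s\in\mathcal Z'$ its sign-function. Consider the quadratic forms $$h[f,f]=\langle h,\bar f\star f\rangle\ (f\in\mathcal D),\qquad b[g,g]=\langle b,(\mathcal J\bar g)*g\rangle\ (g\in C_0^\infty(\mathbb R)),\qquad s[u,u]=\langle s,|u|^2\rangle\ (u\in\mathcal Z).$$ Then, for each of the two signs, $$N_\pm(h)=N_\pm(b)=N_\pm(s).$$
   Context: Notation: $\mathbb R_+=(0,\infty)$; $\Gamma$ is the gamma function; $(\Phi u)(\xi)=(2\pi)^{-1/2}\int_{-\infty}^\infty u(x)e^{-ix\xi}dx$ is the Fourier transform. For a topological vector space $\mathcal L$, $\mathcal L'$ is the space of continuous antilinear functionals; brackets $\langle\cdot,\cdot\rangle$ are linear in the first and antilinear in the second argument. For a real quadratic form $\mathsf h[\varphi,\varphi]$ defined on a linear set $\mathsf D$, $N_\pm(\mathsf h)\in\{0,1,\dots,\infty\}$ denotes the maximal dimension of linear sets $\mathcal M_\pm\subset\mathsf D$ such that $\pm\mathsf h[\varphi,\varphi]>0$ for all $\varphi\in\mathcal M_\pm$, $\varphi\ne0$. $\mathcal Z$ is the set of Schwartz functions $\varphi$ on $\mathbb R$ that extend to entire functions with $|\varphi(z)|\le C_n(1+|z|)^{-n}e^{r|\operatorname{Im}z|}$ for all $n$ and some $r=r(\varphi)>0$; thus $\Phi:C_0^\infty(\mathbb R)\to\mathcal Z$ and $\Phi^*:\mathcal Z\to C_0^\infty(\mathbb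 R)$ are bijections, and $\mathcal Z$ carries the corresponding topology. For $u\in\mathcal Z$, $|u|^2$ (as a function on $\mathbb R$) belongs to $\mathcal Z$. $\mathcal Z_+$ is the set of functions $F$ on $\mathbb R_+$ such that $\Omega(x)=F(e^x)$ belongs to $\mathcal Z$ (with the transferred topology), and $\mathcal Z_+'$ is its dual. For $h\in\mathcal Z_+'$ the distribution $\theta(x)=e^xh(e^x)\in\mathcal Z'$ is defined by $\langle\theta,\Omega\rangle=\langle h,F\rangle$ for $\Omega(x)=F(e^x)$. The distribution $h$ is real if $\langle h,\bar F\rangle=\overline{\langle h,F\rangle}$ for all $F\in\mathcal Z_+$. The $b$- and sign-functions of $h\in\mathcal Z_+'$: put $a=\Phi\theta\in C_0^\infty(\mathbb R)'$, i.e. $\langle a,g\rangle=\langle\theta,\Phi^*g\rangle$; the $b$-function is $b(\xi)=(2\pi)^{-1/2}a(\xi)\Gamma(1-i\xi)^{-1}\in C_0^\infty(\mathbb R)'$, i.e. $\langle b,G\rangle=(2\pi)^{-1/2}\langle a,\Gamma(1+i\,\cdot)^{-1}G\rangle$; the sign-function is $s=\sqrt{2\pi}\,\Phi^*b\in\mathcal Z'$, i.e. $\langle s,\varphi\rangle=\sqrt{2\pi}\langle b,\Phi\varphi\rangle$. $\mathcal D$ is the set of functions $f$ on $\mathbb R_+$ such that $e^{x/2}f(e^x)$ belongs to $\mathcal Z$ as a function of $x\in\mathbb R$. The Laplace convolution is $(\bar f_1\star f_2)(t)=\int_0^t\overline{f_1(s)}f_2(t-s)ds$; for $f_1,f_2\in\mathcal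 D$ it belongs to $\mathcal Z_+$. Further $(g_1*g_2)(\xi)=\int_{-\infty}^\infty g_1(\xi-\eta)g_2(\eta)d\eta$ and $(\mathcal Jg)(\xi)=g(-\xi)$. *)

theory Defs
  imports
    "HOL-Analysis.Analysis"
    "HOL-Library.Extended_Nat"
    "HOL-Library.Function_Algebras"
    "HOL-Library.Complex_Order"
begin

text \<open>
  A function on \<open>(0,\<infinity>)\<close> is represented by its extension by zero to the whole real line, so that
  equality and linear combinations of such functions are those of the type \<open>real \<Rightarrow> complex\<close>.
  The order on \<open>complex\<close> is the one of \<open>Complex_Order\<close>: \<open>0 < z\<close> says that \<open>z\<close> is real and
  positive.
\<close>

definition cscale :: "complex \<Rightarrow> (real \<Rightarrow> complex) \<Rightarrow> (real \<Rightarrow> complex)" where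
  "cscale c f = (\<lambda>x. c * f x)"

interpretation cfun: vector_space cscale
  by standard (auto simp: cscale_def fun_eq_iff algebra_simps)

text \<open>The library dimension \<open>dim\<close> is \<open>0\<close> on spaces of infinite dimension.\<close>

definition lin_dim :: "(real \<Rightarrow> complex) set \<Rightarrow> enat" where
  "lin_dim M = (if \<exists>B. finite B \<and> cfun.span B = M then enat (cfun.dim M) else \<infinity>)"

definition N_pos :: "(real \<Rightarrow> complex) set \<Rightarrow> ((real \<Rightarrow> complex) \<Rightarrow> complex) \<Rightarrow> enat" where
  "N_pos D q = Sup (lin_dim ` {M. cfun.subspace M \<and> M \<subseteq> D \<and> (\<forall>\<phi>\<in>M. \<phi> \<noteq> 0 \<longrightarrow> 0 < q \<phi>)})"

definition N_neg :: "(real \<Rightarrow> complex) set \<Rightarrow> ((real \<Rightarrow> complex) \<Rightarrow> complex) \<Rightarrow> enat" where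
  "N_neg D q = Sup (lin_dim ` {M. cfun.subspace M \<and> M \<subseteq> D \<and> (\<forall>\<phi>\<in>M. \<phi> \<noteq> 0 \<longrightarrow> 0 < - q \<phi>)})"

definition antilinear_on ::
    "(real \<Rightarrow> complex) set \<Rightarrow> ((real \<Rightarrow> complex) \<Rightarrow> complex) \<Rightarrow> bool" where
  "antilinear_on V L \<longleftrightarrow>
     (\<forall>f\<in>V. \<forall>g\<in>V. L (f + g) = L f + L g) \<and> (\<forall>c. \<forall>f\<in>V. L (cscale c f) = cnj c * L f)"

text \<open>The bracket \<open>\<langle>L, f\<rangle>\<close> is \<open>L f\<close>; the values of \<open>L\<close> outside \<open>V\<close> are irrelevant.\<close>

definition dual ::
    "(real \<Rightarrow> complex) set \<Rightarrow> (real \<Rightarrow> complex) topology \<Rightarrow> ((real \<Rightarrow> complex) \<Rightarrow> complex) set" where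
  "dual V T = {L. antilinear_on V L \<and> continuous_map T euclidean L}"

definition nderiv :: "nat \<Rightarrow> (real \<Rightarrow> complex) \<Rightarrow> (real \<Rightarrow> complex)" where
  "nderiv n f = ((\<lambda>g x. vector_derivative g (at x)) ^^ n) f"

definition smooth :: "(real \<Rightarrow> complex) \<Rightarrow> bool" where
  "smooth f \<longleftrightarrow> (\<forall>n x. nderiv n f differentiable (at x))"

definition test_on :: "real set \<Rightarrow> (real \<Rightarrow> complex) set" where
  "test_on K = {g. smooth g \<and> closure {x. g x \<noteq> 0} \<subseteq> K}"

definition test_space :: "(real \<Rightarrow> complex) set" where
  "test_space = {g. smooth g \<and> compact (closure {x. g x \<noteq> 0})}"

definition test_on_topology :: "real set \<Rightarrow> (real \<Rightarrow> complex) topology" where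
  "test_on_topology K = topology_generated_by
     {{\<psi> \<in> test_on K. \<forall>k\<le>N. \<forall>x. norm (nderiv k \<psi> x - nderiv k \<phi> x) < \<epsilon>} | \<phi> N \<epsilon>.
        \<phi> \<in> test_on K \<and> (0::real) < \<epsilon>}"

definition convex_balanced :: "(real \<Rightarrow> complex) set \<Rightarrow> bool" where
  "convex_balanced W \<longleftrightarrow>
     (\<forall>\<phi>\<in>W. \<forall>\<psi>\<in>W. \<forall>t\<in>{0..1::real}. cscale (of_real (1 - t)) \<phi> + cscale (of_real t) \<psi> \<in> W) \<and>
     (\<forall>\<phi>\<in>W. \<forall>c. norm c \<le> 1 \<longrightarrow> cscale c \<phi> \<in> W)"

text \<open>
  The neighbourhoods of zero are generated by the nonempty convex balanced sets whose trace on
  every \<open>test_on K\<close>, \<open>K\<close> compact, is open there (cf. Rudin, Functional Analysis, Section 6.3).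
\<close>

definition test_topology :: "(real \<Rightarrow> complex) topology" where
  "test_topology = topology_generated_by
     {(\<lambda>\<psi>. \<phi> + \<psi>) ` W | \<phi> W. \<phi> \<in> test_space \<and> W \<noteq> {} \<and> W \<subseteq> test_space \<and> convex_balanced W \<and>
        (\<forall>K. compact K \<longrightarrow> openin (test_on_topology K) (W \<inter> test_on K))}"

definition fourier :: "(real \<Rightarrow> complex) \<Rightarrow> real \<Rightarrow> complex" where
  "fourier u \<xi> = of_real (1 / sqrt (2 * pi)) * (LINT x|lborel. u x * exp (- (\<i> * of_real x * of_real \<xi>)))"

definition fourier_adj :: "(real \<Rightarrow> complex) \<Rightarrow> real \<Rightarrow> complex" where
  "fourier_adj g x = of_real (1 / sqrt (2 * pi)) * (LINT \<xi>|lborel. g \<xi> * exp (\<i> * of_real x * of_real \<xi>))"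

definition schwartz :: "(real \<Rightarrow> complex) \<Rightarrow> bool" where
  "schwartz f \<longleftrightarrow> smooth f \<and> (\<forall>m n. \<exists>C. \<forall>x. \<bar>x\<bar> ^ m * norm (nderiv n f x) \<le> C)"

definition Z_space :: "(real \<Rightarrow> complex) set" where
  "Z_space = {\<phi>. schwartz \<phi> \<and>
     (\<exists>E. E holomorphic_on UNIV \<and> (\<forall>x. E (of_real x) = \<phi> x) \<and>
       (\<exists>r>0. \<forall>n::nat. \<exists>C. \<forall>z. norm (E z) \<le> C / (1 + norm z) ^ n * exp (r * \<bar>Im z\<bar>)))}"

definition Z_topology :: "(real \<Rightarrow> complex) topology" where
  "Z_topology = pullback_topology Z_space fourier_adj test_topology"

definition Zp_space :: "(real \<Rightarrow> complex) set" where
  "Zp_space = {F. (\<forall>t\<le>0. F t = 0) \<and> (\<lambda>x. F (exp x)) \<in> Z_space}"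

definition Zp_topology :: "(real \<Rightarrow> complex) topology" where
  "Zp_topology = pullback_topology Zp_space (\<lambda>F x. F (exp x)) Z_topology"

definition D_space :: "(real \<Rightarrow> complex) set" where
  "D_space = {f. (\<forall>t\<le>0. f t = 0) \<and> (\<lambda>x. of_real (exp (x / 2)) * f (exp x)) \<in> Z_space}"

definition cnj_fun :: "(real \<Rightarrow> complex) \<Rightarrow> real \<Rightarrow> complex" where
  "cnj_fun f = (\<lambda>x. cnj (f x))"

definition real_distr :: "((real \<Rightarrow> complex) \<Rightarrow> complex) \<Rightarrow> bool" where
  "real_distr h \<longleftrightarrow> (\<forall>F\<in>Zp_space. h (cnj_fun F) = cnj (h F))"

definition theta :: "((real \<Rightarrow> complex) \<Rightarrow> complex) \<Rightarrow> (real \<Rightarrow> complex) \<Rightarrow> complex" where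
  "theta h \<Omega> = h (\<lambda>t. if 0 < t then \<Omega> (ln t) else 0)"

definition fourier_distr :: "((real \<Rightarrow> complex) \<Rightarrow> complex) \<Rightarrow> (real \<Rightarrow> complex) \<Rightarrow> complex" where
  "fourier_distr \<theta> g = \<theta> (fourier_adj g)"

text \<open>
  Brackets are antilinear in the test function, so the multiplier \<open>1 / \<Gamma>(1 - i\<xi>)\<close> of a distribution
  acts on test functions as its conjugate \<open>1 / \<Gamma>(1 + i\<xi>)\<close>.
\<close>

definition b_function :: "((real \<Rightarrow> complex) \<Rightarrow> complex) \<Rightarrow> (real \<Rightarrow> complex) \<Rightarrow> complex" where
  "b_function h G = of_real (1 / sqrt (2 * pi)) *
     fourier_distr (theta h) (\<lambda>\<xi>. inverse (Gamma (1 + \<i> * of_real \<xi>)) * G \<xi>)"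

definition sign_function :: "((real \<Rightarrow> complex) \<Rightarrow> complex) \<Rightarrow> (real \<Rightarrow> complex) \<Rightarrow> complex" where
  "sign_function h \<phi> = of_real (sqrt (2 * pi)) * b_function h (fourier \<phi>)"

text \<open>\<open>laplace_conv f\<^sub>1 f\<^sub>2\<close> is the Laplace convolution of \<open>f\<^sub>1\<close> and \<open>f\<^sub>2\<close> without the conjugation of
  \<open>f\<^sub>1\<close>; it vanishes at \<open>t \<le> 0\<close>, since the domain of integration is then empty.\<close>

definition laplace_conv :: "(real \<Rightarrow> complex) \<Rightarrow> (real \<Rightarrow> complex) \<Rightarrow> real \<Rightarrow> complex" where
  "laplace_conv f\<^sub>1 f\<^sub>2 t = (LINT s:{0<..<t}|lborel. f\<^sub>1 s * f\<^sub>2 (t - s))"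

definition conv :: "(real \<Rightarrow> complex) \<Rightarrow> (real \<Rightarrow> complex) \<Rightarrow> real \<Rightarrow> complex" where
  "conv g\<^sub>1 g\<^sub>2 \<xi> = (LINT \<eta>|lborel. g\<^sub>1 (\<xi> - \<eta>) * g\<^sub>2 \<eta>)"

definition reflect :: "(real \<Rightarrow> complex) \<Rightarrow> real \<Rightarrow> complex" where
  "reflect g = (\<lambda>\<xi>. g (- \<xi>))"

definition h_form :: "((real \<Rightarrow> complex) \<Rightarrow> complex) \<Rightarrow> (real \<Rightarrow> complex) \<Rightarrow> complex" where
  "h_form h f = h (laplace_conv (cnj_fun f) f)"

definition b_form :: "((real \<Rightarrow> complex) \<Rightarrow> complex) \<Rightarrow> (real \<Rightarrow> complex) \<Rightarrow> complex" where
  "b_form b g = b (conv (reflect (cnj_fun g)) g)"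

definition s_form :: "((real \<Rightarrow> complex) \<Rightarrow> complex) \<Rightarrow> (real \<Rightarrow> complex) \<Rightarrow> complex" where
  "s_form s u = s (\<lambda>x. of_real ((norm (u x))\<^sup>2))"

end

theory Submission
  imports Defs "HOL-Complex_Analysis.Complex_Analysis" "HOL-Probability.Probability"
begin

text \<open>
  Each pair of forms is intertwined by an injective linear map, and such a map carries a definite
  subspace to a definite subspace of the same dimension.

  The Fourier transform maps the form of \<open>s\<close> to that of \<open>b\<close>, since the transform of \<open>\<bar>u\<bar>\<^sup>2\<close> is a
  convolution. For \<open>f\<close> in \<open>\<D>\<close> put \<open>u(x) = e\<^bsup>x/2\<^esup> f(e\<^bsup>x\<^esup>)\<close> and let \<open>w(x) = e\<^bsup>-x/2\<^esup> (L f)(e\<^bsup>-x\<^esup>)\<close>, where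
  \<open>L\<close> is the Laplace transform. Then \<open>w = k\<^sub>a * u\<close> for \<open>a = 1/2\<close>, with the kernel
  \<open>k\<^sub>a(x) = e\<^bsup>-ax\<^esup> exp(- e\<^bsup>-x\<^esup>)\<close> whose Fourier integral is \<open>\<Gamma>(a + i\<xi>)\<close>. Multiplication by \<open>\<Gamma>(1/2 + i\<xi>)\<close>
  is a bijection of the test functions, so \<open>f \<mapsto> w\<close> is a bijection of \<open>\<D>\<close> onto \<open>\<Z>\<close> by the
  Paley-Wiener theorem. Since \<open>L\<close> turns \<open>F\<close>, the Laplace convolution of \<open>f\<close> with its conjugate, into
  \<open>\<bar>L f\<bar>\<^sup>2\<close>, the function \<open>\<Omega>(x) = F(e\<^bsup>x\<^esup>)\<close> satisfies \<open>\<bar>w\<bar>\<^sup>2 = k\<^sub>1 * \<Omega>\<close>. The factor \<open>1 / \<Gamma>(1 + i\<xi>)\<close> in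
  the \<open>b\<close>-function therefore maps the transform of \<open>\<bar>w\<bar>\<^sup>2\<close> to that of \<open>\<Omega>\<close>, and Fourier inversion gives
  the form of \<open>h\<close>.
\<close>

subsection \<open>Dimensions and linear maps\<close>

interpretation cfun_pair: vector_space_pair cscale cscale ..

text \<open>\<open>T\<close> is known to be linear only on \<open>M\<close>. The linear extension
  \<open>S\<close> of its values on a basis of \<open>M\<close> is linear everywhere and agrees with
  \<open>T\<close> on \<open>M\<close>, so the theory of linear maps applies to
  \<open>S\<close>.\<close>

lemma lin_dim_le_image:
  fixes T :: "(real \<Rightarrow> complex) \<Rightarrow> real \<Rightarrow> complex"
  assumes M: "cfun.subspace M"
    and add: "\<And>f g. f \<in> M \<Longrightarrow> g \<in> M \<Longrightarrow> T (f + g) = T f + T g"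
    and scale: "\<And>c f. f \<in> M \<Longrightarrow> T (cscale c f) = cscale c (T f)"
    and ker: "\<And>f. f \<in> M \<Longrightarrow> T f = 0 \<Longrightarrow> f = 0"
  shows "cfun.subspace (T ` M)" and "lin_dim M \<le> lin_dim (T ` M)"
proof -
  obtain B where B: "B \<subseteq> M" "cfun.independent B" "M \<subseteq> cfun.span B"
    by (rule cfun.basis_exists)
  then have span_B: "cfun.span B = M"
    using M cfun.span_minimal by blast
  define S where "S = cfun_pair.construct B T"
  interpret S: Vector_Spaces.linear cscale cscale S
    unfolding S_def using B(2) by (rule cfun_pair.linear_construct)
  \<comment> \<open>Membership in \<open>M\<close> is carried through the induction, because
    additivity of \<open>T\<close> may be used only there.\<close>
  have "f \<in> cfun.span B \<Longrightarrow> f \<in> M \<and> S f = T f" for f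
  proof (induction rule: cfun.span_induct_alt)
    case base
    have "T 0 = 0"
      using scale[of 0 0] cfun.subspace_0[OF M] by simp
    then show ?case
      using cfun.subspace_0[OF M] by (simp only: S.zero simp_thms)
  next
    case (step c x y)
    then have "x \<in> M" "y \<in> M"
      using B(1) by auto
    moreover from this have "cscale c x \<in> M"
      using cfun.subspace_scale[OF M] by simp
    moreover have "S x = T x"
      unfolding S_def using B(2) step.hyps by (rule cfun_pair.construct_basis)
    ultimately show ?case
      using step.IH cfun.subspace_add[OF M] by (simp only: S.add S.scale add scale simp_thms)
  qed
  then have S_eq: "f \<in> M \<Longrightarrow> S f = T f" for f
    using span_B by blast
  then have img: "S ` M = T ` M" by auto
  have inj: "inj_on S M"
    using S.inj_on_iff_eq_0[OF M] ker S_eq by simp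
  show "cfun.subspace (T ` M)"
    using S.subspace_image[OF M] img by simp
  \<comment> \<open>A finite spanning set of the image pulls back to one of \<open>M\<close>, and
    then both dimensions equal the number of elements of \<open>B\<close>. If the image has no
    finite spanning set, its dimension is \<infinity> and the inequality is trivial.\<close>
  have "lin_dim M = lin_dim (S ` M)" if "finite C" "cfun.span C = S ` M" for C
  proof -
    have "C \<subseteq> S ` M"
      using that(2) cfun.span_superset by blast
    from finite_subset_image[OF that(1) this]
    obtain C0 where C0: "C0 \<subseteq> M" "finite C0" "C = S ` C0"
      by auto
    have "cfun.span C0 \<subseteq> M"
      using C0 M cfun.span_minimal by blast
    moreover have "S ` cfun.span C0 = S ` M"
      using that C0 S.span_image by simp
    ultimately have *: "cfun.span C0 = M"
      using inj_on_image_eq_iff[OF inj] by blast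
    have "cfun.independent (S ` B)"
      using S.dependent_inj_imageD[of B] B(2) inj span_B by auto
    moreover have "cfun.span (S ` B) = cfun.span (S ` M)"
      using S.span_image span_B cfun.span_span by metis
    ultimately have "cfun.dim (S ` M) = card (S ` B)"
      by (rule cfun.dim_eq_card[rotated])
    also have "\<dots> = card B"
      using inj_on_subset[OF inj B(1)] by (rule card_image)
    also have "\<dots> = cfun.dim M"
      using cfun.dim_eq_card[OF _ B(2), of M] span_B cfun.span_span by metis
    finally have "cfun.dim (S ` M) = cfun.dim M" .
    moreover have "\<exists>B. finite B \<and> cfun.span B = M" "\<exists>B. finite B \<and> cfun.span B = S ` M"
      using * C0(2) that by blast+
    ultimately show ?thesis
      by (simp add: lin_dim_def)
  qed
  moreover have "lin_dim (S ` M) = \<infinity>" if "\<nexists>C. finite C \<and> cfun.span C = S ` M"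
    using that by (simp add: lin_dim_def)
  ultimately have "lin_dim M \<le> lin_dim (S ` M)"
    by (metis enat_ord_simps(3) order_refl)
  then show "lin_dim M \<le> lin_dim (T ` M)"
    by (simp only: img)
qed

text \<open>Transfer principle, applied three times around a cycle of the three domains: an
  injective intertwining map sends every competitor \<open>M\<close> for the left supremum to a
  competitor for the right one, without loss of dimension.\<close>

lemma N_pos_le:
  assumes T: "T \<in> D1 \<rightarrow> D2"
    and add: "\<And>f g. f \<in> D1 \<Longrightarrow> g \<in> D1 \<Longrightarrow> T (f + g) = T f + T g"
    and scale: "\<And>c f. f \<in> D1 \<Longrightarrow> T (cscale c f) = cscale c (T f)"
    and ker: "\<And>f. f \<in> D1 \<Longrightarrow> T f = 0 \<Longrightarrow> f = 0"
    and form: "\<And>f. f \<in> D1 \<Longrightarrow> q2 (T f) = q1 f"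
  shows "N_pos D1 q1 \<le> N_pos D2 q2"
  unfolding N_pos_def
proof (rule SUP_least)
  fix M assume M: "M \<in> {M. cfun.subspace M \<and> M \<subseteq> D1 \<and> (\<forall>\<phi>\<in>M. \<phi> \<noteq> 0 \<longrightarrow> 0 < q1 \<phi>)}"
  then have "M \<subseteq> D1" by simp
  then have lin: "cfun.subspace (T ` M)" "lin_dim M \<le> lin_dim (T ` M)"
    using lin_dim_le_image[of M T] M add scale ker by (simp_all add: subset_iff)
  \<comment> \<open>Ensures that a nonzero element of the image comes from a nonzero element of
    \<open>M\<close>.\<close>
  have "T 0 = 0"
    using scale[of 0 0] M cfun.subspace_0 by auto
  then have "0 < q2 \<phi>" if "\<phi> \<in> T ` M" "\<phi> \<noteq> 0" for \<phi>
    using that M form by (smt (verit) imageE mem_Collect_eq subsetD)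
  moreover have "T ` M \<subseteq> D2"
    using T M by blast
  ultimately show "lin_dim M \<le> Sup (lin_dim ` {M. cfun.subspace M \<and> M \<subseteq> D2 \<and> (\<forall>\<phi>\<in>M. \<phi> \<noteq> 0 \<longrightarrow> 0 < q2 \<phi>)})"
    using lin by (intro order_trans[OF lin(2)] SUP_upper) auto
qed

lemma N_neg_eq_N_pos: "N_neg D q = N_pos D (\<lambda>f. - q f)"
  by (simp add: N_neg_def N_pos_def)

subsection \<open>Smooth functions\<close>

lemma nderiv_0 [simp]: "nderiv 0 f = f"
  by (simp add: nderiv_def)

lemma nderiv_Suc: "nderiv (Suc n) f = (\<lambda>x. vector_derivative (nderiv n f) (at x))"
  by (simp add: nderiv_def)

text \<open>Peels off the innermost derivative instead of the outermost, as inductions on the order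
  with an arbitrary function require.\<close>

lemma nderiv_Suc': "nderiv (Suc n) f = nderiv n (\<lambda>x. vector_derivative f (at x))"
  by (simp add: nderiv_def funpow_swap1 del: funpow.simps(2)) (simp add: funpow_Suc_right del: funpow.simps(2))

lemma smooth_nderiv: "smooth f \<Longrightarrow> smooth (nderiv n f)"
  unfolding smooth_def by (metis comp_apply funpow_add nderiv_def)

lemma smooth_has_vector_derivative:
  "smooth f \<Longrightarrow> (nderiv n f has_vector_derivative nderiv (Suc n) f x) (at x)"
  by (simp add: nderiv_Suc smooth_def vector_derivative_works)

lemma smooth_continuous: "smooth f \<Longrightarrow> continuous_on S (nderiv n f)"
  using smooth_has_vector_derivative has_vector_derivative_continuous
  by (metis continuous_at_imp_continuous_on)

text \<open>A guessed sequence, each member the derivative of the one before, settles smoothness and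
  identifies all derivatives at once.\<close>

lemma smoothI:
  assumes "\<And>n x. (F n has_vector_derivative F (Suc n) x) (at x)" "F 0 = f"
  shows "smooth f" "nderiv n f = F n"
proof -
  have *: "nderiv n f = F n" for n
    by (induction n) (auto simp: assms(2) nderiv_Suc vector_derivative_at[OF assms(1)])
  then show "nderiv n f = F n" .
  show "smooth f"
    unfolding smooth_def * using assms(1) differentiableI_vector by blast
qed

text \<open>\<open>smooth\<close> is this property for all orders. Fixing the order makes products
  accessible to induction: the derivative of a product is a sum of products to which the claim for
  one order less applies.\<close>

definition diff_upto :: "nat \<Rightarrow> (real \<Rightarrow> complex) \<Rightarrow> bool" where
  "diff_upto n f \<longleftrightarrow> (\<forall>k<n. \<forall>x. nderiv k f differentiable (at x))"

lemma diff_upto_Suc: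
  "diff_upto (Suc n) f \<longleftrightarrow>
     (\<forall>x. f differentiable (at x)) \<and> diff_upto n (\<lambda>x. vector_derivative f (at x))"
  unfolding diff_upto_def by (auto simp: less_Suc_eq_0_disj nderiv_Suc')

lemma diff_upto_add: "diff_upto n f \<Longrightarrow> diff_upto n g \<Longrightarrow> diff_upto n (\<lambda>x. f x + g x)"
proof (induction n arbitrary: f g)
  case (Suc n)
  then have "vector_derivative (\<lambda>x. f x + g x) (at x) =
      vector_derivative f (at x) + vector_derivative g (at x)" for x
    by (auto simp: diff_upto_Suc)
  then show ?case using Suc by (auto simp: diff_upto_Suc)
qed (simp add: diff_upto_def)

lemma diff_upto_SucD: "diff_upto (Suc n) f \<Longrightarrow> diff_upto n f"
  by (simp add: diff_upto_def)

lemma diff_upto_mult: "diff_upto n f \<Longrightarrow> diff_upto n g \<Longrightarrow> diff_upto n (\<lambda>x. f x * g x)"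
proof (induction n arbitrary: f g)
  case (Suc n)
  then have "((\<lambda>x. f x * g x) has_vector_derivative
      f x * vector_derivative g (at x) + vector_derivative f (at x) * g x) (at x)" for x
    by (intro has_vector_derivative_mult) (auto simp: diff_upto_Suc vector_derivative_works)
  then have *: "vector_derivative (\<lambda>x. f x * g x) (at x) =
      f x * vector_derivative g (at x) + vector_derivative f (at x) * g x" for x
    using vector_derivative_at by blast
  have "diff_upto n (\<lambda>x. f x * vector_derivative g (at x) + vector_derivative f (at x) * g x)"
    using Suc diff_upto_SucD by (intro diff_upto_add Suc.IH) (auto simp: diff_upto_Suc)
  then show ?case
    using Suc.prems by (simp add: diff_upto_Suc *)
qed (simp add: diff_upto_def)

lemma smooth_mult: "smooth f \<Longrightarrow> smooth g \<Longrightarrow> smooth (\<lambda>x. f x * g x)"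
proof -
  have "smooth f \<longleftrightarrow> (\<forall>n. diff_upto n f)" for f
    unfolding smooth_def diff_upto_def by blast
  then show "smooth f \<Longrightarrow> smooth g \<Longrightarrow> smooth (\<lambda>x. f x * g x)"
    using diff_upto_mult by blast
qed

text \<open>Along the real line the complex derivatives are the real ones. A general open
  \<open>S\<close> is allowed because of the Gamma function, which has poles off the line.\<close>

lemma smooth_holomorphic:
  assumes E: "E holomorphic_on S" "open S" and S: "\<And>x. complex_of_real x \<in> S"
  shows "smooth (\<lambda>x. E (of_real x))" "nderiv n (\<lambda>x. E (of_real x)) = (\<lambda>x. (deriv ^^ n) E (of_real x))"
proof -
  have "((\<lambda>x. (deriv ^^ n) E (of_real x)) has_vector_derivative (deriv ^^ Suc n) E (of_real x)) (at x)" for n x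
  proof -
    have "((deriv ^^ n) E has_field_derivative (deriv ^^ Suc n) E (of_real x)) (at (of_real x))"
      using holomorphic_higher_deriv[OF E] E(2) S holomorphic_derivI by fastforce
    then show ?thesis
      using has_field_derivative_at_within has_vector_derivative_real_field by blast
  qed
  from smoothI[of "\<lambda>n x. (deriv ^^ n) E (of_real x)", OF this]
  show "smooth (\<lambda>x. E (of_real x))" "nderiv n (\<lambda>x. E (of_real x)) = (\<lambda>x. (deriv ^^ n) E (of_real x))"
    by auto
qed

section \<open>Smooth functions of compact support\<close>

lemma test_spaceI:
  assumes "smooth g" "\<And>x. R < \<bar>x\<bar> \<Longrightarrow> g x = 0"
  shows "g \<in> test_space"
proof -
  have "{x. g x \<noteq> 0} \<subseteq> {-R..R}"
    using assms(2) by (force simp: abs_le_iff)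
  then have "compact (closure {x. g x \<noteq> 0})"
    using bounded_subset[OF bounded_closed_interval] by (simp add: compact_closure)
  then show ?thesis
    using assms(1) by (simp add: test_space_def)
qed

lemma test_spaceE:
  assumes "g \<in> test_space"
  obtains R where "R > 0" "\<And>x. R < \<bar>x\<bar> \<Longrightarrow> g x = 0"
proof -
  have "bounded {x. g x \<noteq> 0}"
    using assms by (simp add: test_space_def compact_closure)
  then obtain R where "R > 0" "\<forall>x\<in>{x. g x \<noteq> 0}. norm x \<le> R"
    using bounded_pos by blast
  then show ?thesis using that by force
qed

lemma test_space_mult:
  assumes "g \<in> test_space" "smooth f"
  shows "(\<lambda>x. f x * g x) \<in> test_space"
proof -
  obtain R where "\<And>x. R < \<bar>x\<bar> \<Longrightarrow> g x = 0"
    using test_spaceE assms(1) by metis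
  then show ?thesis
    using assms by (intro test_spaceI[where R=R] smooth_mult) (auto simp: test_space_def)
qed

subsection \<open>The space of entire test functions\<close>

lemma cmod_exp_mult_ii [simp]:
  "norm (exp (- (\<i> * complex_of_real x * complex_of_real y))) = 1"
  "norm (exp (\<i> * complex_of_real x * complex_of_real y)) = 1"
  by (simp_all add: norm_exp_eq_Re)

lemma integrable_mult_bounded:
  fixes f g :: "real \<Rightarrow> complex"
  assumes "integrable lborel f" "g \<in> borel_measurable borel" "\<And>x. norm (g x) \<le> B"
  shows "integrable lborel (\<lambda>x. f x * g x)"
proof (rule Bochner_Integration.integrable_bound)
  show "integrable lborel (\<lambda>x. B * norm (f x))"
    using assms(1) by simp
  show "(\<lambda>x. f x * g x) \<in> borel_measurable lborel"
    using assms borel_measurable_integrable[of lborel f] by simp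
  have "norm (f x * g x) \<le> B * norm (f x)" for x
    using mult_left_mono[OF assms(3)[of x], of "norm (f x)"] by (simp add: norm_mult mult.commute)
  then show "AE x in lborel. norm (f x * g x) \<le> norm (B * norm (f x))"
    by (intro AE_I2) (metis abs_ge_self order_trans real_norm_def)
qed

lemma integrable_fourier:
  fixes u :: "real \<Rightarrow> complex"
  assumes "integrable lborel u"
  shows "integrable lborel (\<lambda>x. u x * exp (- (\<i> * of_real x * of_real \<xi>)))"
    and "integrable lborel (\<lambda>x. u x * exp (\<i> * of_real x * of_real \<xi>))"
    and "integrable lborel (\<lambda>x. u x * exp (\<i> * of_real \<xi> * of_real x))"
  using assms by (auto intro!: integrable_mult_bounded[where B=1])

lemma integrable_decay:
  fixes f :: "real \<Rightarrow> complex"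
  assumes "f \<in> borel_measurable borel" "\<And>x. norm (f x) \<le> C / (1 + \<bar>x\<bar>)\<^sup>2"
  shows "integrable lborel f"
proof (rule Bochner_Integration.integrable_bound)
  have "integrable lborel (\<lambda>x::real. inverse (1 + x^2))"
    using integrable_inverse_1_plus_square by (simp add: set_integrable_def einterval_def)
  then show "integrable lborel (\<lambda>x::real. \<bar>C\<bar> * inverse (1 + x^2))"
    by simp
  show "f \<in> borel_measurable lborel"
    using assms(1) by simp
  have "norm (f x) \<le> norm (\<bar>C\<bar> * inverse (1 + x^2))" for x
  proof -
    have "1 + x\<^sup>2 \<le> (1 + \<bar>x\<bar>)\<^sup>2"
      by (simp add: power2_eq_square algebra_simps)
    moreover have "0 < 1 + x\<^sup>2" by (simp add: add_pos_nonneg)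
    ultimately have "\<bar>C\<bar> / (1 + \<bar>x\<bar>)\<^sup>2 \<le> \<bar>C\<bar> / (1 + x\<^sup>2)"
      by (intro divide_left_mono) auto
    moreover have "C / (1 + \<bar>x\<bar>)\<^sup>2 \<le> \<bar>C\<bar> / (1 + \<bar>x\<bar>)\<^sup>2"
      by (intro divide_right_mono) auto
    ultimately show ?thesis
      using assms(2)[of x] by (simp add: divide_inverse abs_mult)
  qed
  then show "AE x in lborel. norm (f x) \<le> norm (\<bar>C\<bar> * inverse (1 + x^2))"
    by simp
qed

text \<open>The Schwartz condition follows from the growth bound: Cauchy's inequality on the unit
  circle around a real point turns decay of \<open>E\<close> into decay of every derivative.\<close>

lemma Z_spaceI:
  assumes E: "E holomorphic_on UNIV" and \<phi>: "\<And>x. E (of_real x) = \<phi> x" and r: "r > 0"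
    and bd: "\<And>n::nat. \<exists>C. \<forall>z. norm (E z) \<le> C / (1 + norm z) ^ n * exp (r * \<bar>Im z\<bar>)"
  shows "\<phi> \<in> Z_space"
proof -
  have \<phi>_eq: "\<phi> = (\<lambda>x. E (of_real x))"
    using \<phi> by auto
  have "\<exists>C. \<forall>x. \<bar>x\<bar> ^ m * norm (nderiv n \<phi> x) \<le> C" for m n
  proof -
    obtain C where C: "\<And>z. norm (E z) \<le> C / (1 + norm z) ^ m * exp (r * \<bar>Im z\<bar>)"
      using bd by blast
    have "C \<ge> 0"
      using order_trans[OF norm_ge_zero C[of 0]] by simp
    \<comment> \<open>\<open>fact n\<close> is from Cauchy's inequality, \<open>2 ^ m\<close> from
      \<open>1 + \<bar>x\<bar> \<le> 2 * (1 + norm z)\<close> on the unit circle around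
      \<open>x\<close>, and \<open>exp r\<close> from \<open>\<bar>Im z\<bar> \<le> 1\<close>
      there.\<close>
    have "\<bar>x\<bar> ^ m * norm (nderiv n \<phi> x) \<le> fact n * (C * 2 ^ m * exp r)" for x
    proof -
      have "norm (E z) \<le> C * 2 ^ m * exp r / (1 + \<bar>x\<bar>) ^ m" if "norm (of_real x - z) = 1" for z
      proof -
        have "\<bar>x\<bar> \<le> norm z + 1"
          using norm_triangle_ineq[of "of_real x - z" z] that by simp
        then have "(1 + \<bar>x\<bar>) / 2 \<le> 1 + norm z"
          using norm_ge_zero[of z] by argo
        then have "((1 + \<bar>x\<bar>) / 2) ^ m \<le> (1 + norm z) ^ m"
          by (intro power_mono) auto
        then have "C / (1 + norm z) ^ m \<le> C / ((1 + \<bar>x\<bar>) / 2) ^ m"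
          using \<open>C \<ge> 0\<close> by (intro divide_left_mono mult_pos_pos zero_less_power) (auto simp: add_pos_nonneg)
        also have "\<dots> = C * 2 ^ m / (1 + \<bar>x\<bar>) ^ m"
          by (simp add: power_divide)
        finally have 1: "C / (1 + norm z) ^ m \<le> C * 2 ^ m / (1 + \<bar>x\<bar>) ^ m" .
        have "\<bar>Im z\<bar> \<le> 1"
          using abs_Im_le_cmod[of "of_real x - z"] that by simp
        then have 2: "exp (r * \<bar>Im z\<bar>) \<le> exp r"
          using r by simp
        show ?thesis
          using order_trans[OF C mult_mono[OF 1 2]] \<open>C \<ge> 0\<close> by simp
      qed
      then have "norm ((deriv ^^ n) E (of_real x)) \<le> fact n * (C * 2 ^ m * exp r / (1 + \<bar>x\<bar>) ^ m) / 1 ^ n"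
        using E by (intro Cauchy_inequality)
          (auto intro: holomorphic_on_subset holomorphic_on_imp_continuous_on)
      then have "(1 + \<bar>x\<bar>) ^ m * norm (nderiv n \<phi> x) \<le> fact n * (C * 2 ^ m * exp r)"
        unfolding \<phi>_eq smooth_holomorphic(2)[OF E open_UNIV UNIV_I]
        by (simp add: field_simps add_pos_nonneg)
      moreover have "\<bar>x\<bar> ^ m \<le> (1 + \<bar>x\<bar>) ^ m"
        by (intro power_mono) auto
      ultimately show ?thesis
        by (meson mult_right_mono norm_ge_zero order_trans)
    qed
    then show ?thesis by blast
  qed
  then have "schwartz \<phi>"
    unfolding schwartz_def using smooth_holomorphic(1)[OF E open_UNIV UNIV_I] \<phi>_eq by auto
  then show ?thesis
    unfolding Z_space_def using assms by blast
qed

lemma Z_spaceE: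
  assumes "\<phi> \<in> Z_space"
  obtains E r where "E holomorphic_on UNIV" "\<And>x. E (of_real x) = \<phi> x" "r > 0"
    "\<And>n::nat. \<exists>C\<ge>0. \<forall>z. norm (E z) \<le> C / (1 + norm z) ^ n * exp (r * \<bar>Im z\<bar>)"
proof -
  obtain E r where *: "E holomorphic_on UNIV" "\<And>x. E (of_real x) = \<phi> x" "r > 0"
    "\<And>n::nat. \<exists>C. \<forall>z. norm (E z) \<le> C / (1 + norm z) ^ n * exp (r * \<bar>Im z\<bar>)"
    using assms unfolding Z_space_def by blast
  have "\<exists>C\<ge>0. \<forall>z. norm (E z) \<le> C / (1 + norm z) ^ n * exp (r * \<bar>Im z\<bar>)" for n :: nat
  proof -
    obtain C where C: "\<And>z. norm (E z) \<le> C / (1 + norm z) ^ n * exp (r * \<bar>Im z\<bar>)"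
      using *(4) by blast
    have "C \<ge> 0"
      using order_trans[OF norm_ge_zero C[of 0]] by simp
    with C show ?thesis by blast
  qed
  with * show ?thesis using that by blast
qed

lemma Z_space_decay:
  assumes "u \<in> Z_space"
  obtains C where "C \<ge> 0" "\<And>x. norm (u x) \<le> C / (1 + \<bar>x\<bar>) ^ n"
proof -
  obtain E r where E: "\<And>x. E (of_real x) = u x"
    "\<And>n::nat. \<exists>C\<ge>0. \<forall>z. norm (E z) \<le> C / (1 + norm z) ^ n * exp (r * \<bar>Im z\<bar>)"
    by (rule Z_spaceE[OF assms]) blast
  obtain C where "C \<ge> 0" "\<And>z. norm (E z) \<le> C / (1 + norm z) ^ n * exp (r * \<bar>Im z\<bar>)"
    using E(2) by blast
  then have "C \<ge> 0" "norm (u x) \<le> C / (1 + \<bar>x\<bar>) ^ n" for x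
    using E(1)[of x] by (metis Im_complex_of_real abs_zero exp_zero mult.right_neutral mult_zero_right norm_of_real)+
  then show ?thesis using that by blast
qed

lemma Z_space_continuous: "u \<in> Z_space \<Longrightarrow> continuous_on S u"
  using smooth_continuous[of u S 0] by (simp add: Z_space_def schwartz_def)

lemma Z_space_measurable: "u \<in> Z_space \<Longrightarrow> u \<in> borel_measurable borel"
  by (simp add: Z_space_continuous borel_measurable_continuous_onI)

lemma Z_space_bounded:
  assumes "u \<in> Z_space"
  obtains B where "B \<ge> 0" "\<And>x. norm (u x) \<le> B"
  using Z_space_decay[OF assms, of 0] by auto

text \<open>The weight is what \<open>n\<close> differentiations in the dual variable produce under
  the Fourier integral.\<close>

lemma Z_space_integrable_moment:
  assumes "u \<in> Z_space"
  shows "integrable lborel (\<lambda>x. (- \<i> * of_real x) ^ n * u x)"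
proof -
  obtain C where C: "\<And>x. norm (u x) \<le> C / (1 + \<bar>x\<bar>) ^ (n + 2)" "C \<ge> 0"
    using Z_space_decay[OF assms, of "n + 2"] by blast
  show ?thesis
  proof (rule integrable_decay)
    show "(\<lambda>x. (- \<i> * of_real x) ^ n * u x) \<in> borel_measurable borel"
      using Z_space_measurable[OF assms] by simp
    fix x
    have "norm ((- \<i> * of_real x) ^ n * u x) = \<bar>x\<bar> ^ n * norm (u x)"
      by (simp add: norm_mult norm_power)
    also have "\<dots> \<le> (1 + \<bar>x\<bar>) ^ n * (C / (1 + \<bar>x\<bar>) ^ (n + 2))"
      using C by (intro mult_mono power_mono) auto
    also have "\<dots> = C / (1 + \<bar>x\<bar>)\<^sup>2"
      by (simp add: power_add add_nonneg_eq_0_iff power2_eq_square)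
    finally show "norm ((- \<i> * of_real x) ^ n * u x) \<le> C / (1 + \<bar>x\<bar>)\<^sup>2" .
  qed
qed

lemma Z_space_integrable: "u \<in> Z_space \<Longrightarrow> integrable lborel u"
  using Z_space_integrable_moment[of u 0] by simp

text \<open>On the real line the square of the modulus is the restriction of the entire function
  \<open>E z * cnj (E (cnj z))\<close>. The exponential types add up to \<open>2 * r\<close>; the
  decay is taken from the first factor alone, the second being bounded with power 0.\<close>

lemma Z_space_norm_square:
  assumes "u \<in> Z_space"
  shows "(\<lambda>x. of_real ((norm (u x))\<^sup>2)) \<in> Z_space"
proof -
  obtain E r where E: "E holomorphic_on UNIV" "\<And>x. E (of_real x) = u x" "r > 0"
    "\<And>n::nat. \<exists>C\<ge>0. \<forall>z. norm (E z) \<le> C / (1 + norm z) ^ n * exp (r * \<bar>Im z\<bar>)"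
    by (rule Z_spaceE[OF assms]) blast
  show ?thesis
  proof (rule Z_spaceI[where E="\<lambda>z. E z * (cnj \<circ> E \<circ> cnj) z" and r="2 * r"])
    have "surj cnj"
      by (metis complex_cnj_cnj surj_def)
    then have "cnj \<circ> E \<circ> cnj holomorphic_on UNIV"
      using E(1) by (intro holomorphic_on_compose_cnj_cnj) auto
    then show "(\<lambda>z. E z * (cnj \<circ> E \<circ> cnj) z) holomorphic_on UNIV"
      using E(1) by (intro holomorphic_on_mult)
    show "E (of_real x) * (cnj \<circ> E \<circ> cnj) (of_real x) = of_real ((norm (u x))\<^sup>2)" for x
      by (simp add: E(2) complex_norm_square del: of_real_power)
    show "2 * r > 0" using E(3) by simp
    fix n :: nat
    obtain C where C: "C \<ge> 0" "\<And>z. norm (E z) \<le> C / (1 + norm z) ^ n * exp (r * \<bar>Im z\<bar>)"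
      using E(4) by blast
    obtain D where D: "D \<ge> 0" "\<And>z. norm (E z) \<le> D / (1 + norm z) ^ 0 * exp (r * \<bar>Im z\<bar>)"
      using E(4) by blast
    have "norm (E z * (cnj \<circ> E \<circ> cnj) z) \<le> C * D / (1 + norm z) ^ n * exp (2 * r * \<bar>Im z\<bar>)" for z
    proof -
      have "norm (E z * (cnj \<circ> E \<circ> cnj) z) = norm (E z) * norm (E (cnj z))"
        by (simp add: norm_mult)
      also have "\<dots> \<le> (C / (1 + norm z) ^ n * exp (r * \<bar>Im z\<bar>)) * (D * exp (r * \<bar>Im z\<bar>))"
        using C(2)[of z] D(2)[of "cnj z"] C(1) by (intro mult_mono) auto
      also have "\<dots> = C * D / (1 + norm z) ^ n * exp (2 * r * \<bar>Im z\<bar>)"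
        by (simp add: mult_ac mult_exp_exp)
      finally show ?thesis .
    qed
    then show "\<exists>C. \<forall>z. norm (E z * (cnj \<circ> E \<circ> cnj) z) \<le> C / (1 + norm z) ^ n * exp (2 * r * \<bar>Im z\<bar>)"
      by blast
  qed
qed

section \<open>Smoothness of the Fourier transform\<close>

text \<open>The Taylor remainder of the exponential is of second order, so the second moment of
  \<open>u\<close> bounds the error of the linear approximation by a multiple of
  \<open>(\<eta> - \<xi>)\<^sup>2\<close>.\<close>

lemma fourier_has_vector_derivative:
  assumes u: "integrable lborel u" "integrable lborel (\<lambda>x. (- \<i> * of_real x) * u x)"
    and u2: "integrable lborel (\<lambda>x. (- \<i> * of_real x)\<^sup>2 * u x)"
  shows "(fourier u has_vector_derivative fourier (\<lambda>x. (- \<i> * of_real x) * u x) \<xi>) (at \<xi>)"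
proof -
  let ?e = "\<lambda>x \<xi>. exp (- (\<i> * complex_of_real x * complex_of_real \<xi>))"
  let ?G = "fourier (\<lambda>x. (- \<i> * of_real x) * u x) \<xi>"
  let ?B = "1 / sqrt (2 * pi) * (LINT x|lborel. norm ((- \<i> * of_real x)\<^sup>2 * u x))"
  have bound: "norm (fourier u \<eta> - fourier u \<xi> - (\<eta> - \<xi>) *\<^sub>R ?G) \<le> ?B * (\<eta> - \<xi>)\<^sup>2" for \<eta>
  proof -
    let ?h = "\<eta> - \<xi>"
    let ?R = "\<lambda>x. u x * ?e x \<eta> - u x * ?e x \<xi> - complex_of_real ?h * ((- \<i> * of_real x) * u x * ?e x \<xi>)"
    have int: "integrable lborel ?R"
      using u by (intro Bochner_Integration.integrable_diff integrable_mult_right integrable_fourier) auto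
    have "(LINT x|lborel. ?R x) = (LINT x|lborel. u x * ?e x \<eta>) - (LINT x|lborel. u x * ?e x \<xi>)
        - of_real ?h * (LINT x|lborel. (- \<i> * of_real x) * u x * ?e x \<xi>)"
      by (simp only: Bochner_Integration.integral_diff Bochner_Integration.integrable_diff
          integrable_mult_right integrable_fourier u integral_mult_right_zero)
    then have "fourier u \<eta> - fourier u \<xi> - ?h *\<^sub>R ?G = of_real (1 / sqrt (2 * pi)) * (LINT x|lborel. ?R x)"
      unfolding fourier_def by (simp only: scaleR_conv_of_real right_diff_distrib mult_ac)
    then have eq: "norm (fourier u \<eta> - fourier u \<xi> - ?h *\<^sub>R ?G) = 1 / sqrt (2 * pi) * norm (LINT x|lborel. ?R x)"
      by (simp add: norm_mult norm_divide)
    have "norm (LINT x|lborel. ?R x) \<le> (LINT x|lborel. ?h\<^sup>2 * norm ((- \<i> * of_real x)\<^sup>2 * u x))"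
    proof (rule order_trans[OF integral_norm_bound integral_mono])
      show "integrable lborel (\<lambda>x. norm (?R x))"
        using int by simp
      show "integrable lborel (\<lambda>x. ?h\<^sup>2 * norm ((- \<i> * of_real x)\<^sup>2 * u x))"
        using u2 by simp
      fix x
      \<comment> \<open>The kernel at \<open>\<eta>\<close> is the kernel at \<open>\<xi>\<close>
        times \<open>iexp ?y\<close>, so \<open>?R x\<close> has the modulus of \<open>u x\<close>
        times the remainder of \<open>iexp\<close> after its linear term.\<close>
      let ?y = "- (x * ?h)"
      have "?e x \<eta> = ?e x \<xi> * iexp ?y"
        by (simp add: mult_exp_exp algebra_simps)
      then have "?R x = u x * ?e x \<xi> * (iexp ?y - (1 + \<i> * ?y))"
        by (simp add: algebra_simps)
      then have "norm (?R x) = norm (u x) * norm (iexp ?y - (1 + \<i> * ?y))"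
        by (simp only: norm_mult cmod_exp_mult_ii mult_1_right)
      moreover have "norm (iexp ?y - (1 + \<i> * ?y)) \<le> ?y\<^sup>2"
      proof -
        have "norm (iexp ?y - (1 + \<i> * ?y)) \<le> \<bar>?y\<bar>\<^sup>2 / 2"
          using iexp_approx1[of ?y 1] by (simp add: numeral_2_eq_2)
        also have "\<dots> = ?y\<^sup>2 / 2"
          by (simp only: power2_abs)
        also have "\<dots> \<le> ?y\<^sup>2"
          using zero_le_power2[of ?y] by argo
        finally show ?thesis .
      qed
      ultimately have "norm (?R x) \<le> norm (u x) * ?y\<^sup>2"
        by (simp only: mult_left_mono norm_ge_zero)
      also have "\<dots> = ?h\<^sup>2 * norm ((- \<i> * of_real x)\<^sup>2 * u x)"
        by (simp add: norm_mult norm_power power_mult_distrib)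
      finally show "norm (?R x) \<le> ?h\<^sup>2 * norm ((- \<i> * of_real x)\<^sup>2 * u x)" .
    qed
    then show ?thesis
      unfolding eq by (simp add: mult_ac divide_right_mono)
  qed
  show ?thesis
    unfolding has_vector_derivative_def
  proof (rule has_derivativeI_sandwich[where e=1 and H="\<lambda>\<eta>. ?B * \<bar>\<eta> - \<xi>\<bar>"])
    show "norm (fourier u \<eta> - fourier u \<xi> - (\<eta> - \<xi>) *\<^sub>R ?G) / norm (\<eta> - \<xi>) \<le> ?B * \<bar>\<eta> - \<xi>\<bar>"
      if "\<eta> \<noteq> \<xi>" for \<eta>
    proof -
      have "(\<eta> - \<xi>)\<^sup>2 = \<bar>\<eta> - \<xi>\<bar> * \<bar>\<eta> - \<xi>\<bar>"
        by (simp add: power2_eq_square)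
      with bound[of \<eta>] that show ?thesis
        by (simp add: divide_le_eq mult.assoc)
    qed
    have "((\<lambda>\<eta>. ?B * \<bar>\<eta> - \<xi>\<bar>) \<longlongrightarrow> ?B * \<bar>\<xi> - \<xi>\<bar>) (at \<xi>)"
      by (intro tendsto_intros)
    then show "((\<lambda>\<eta>. ?B * \<bar>\<eta> - \<xi>\<bar>) \<longlongrightarrow> 0) (at \<xi>)"
      by simp
  qed (auto intro: bounded_linear_scaleR_left)
qed

lemma smooth_fourier:
  assumes "u \<in> Z_space"
  shows "smooth (fourier u)"
proof (rule smoothI(1)[where F="\<lambda>n. fourier (\<lambda>x. (- \<i> * of_real x) ^ n * u x)"])
  fix n \<xi>
  have "integrable lborel (\<lambda>x. (- \<i> * of_real x) ^ k * ((- \<i> * of_real x) ^ n * u x))" for k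
    using Z_space_integrable_moment[OF assms, of "k + n"] by (simp add: power_add mult.assoc)
  from this[of 0] this[of 1] this[of 2]
  have "(fourier (\<lambda>x. (- \<i> * of_real x) ^ n * u x) has_vector_derivative
      fourier (\<lambda>x. (- \<i> * of_real x) * ((- \<i> * of_real x) ^ n * u x)) \<xi>) (at \<xi>)"
    by (intro fourier_has_vector_derivative) simp_all
  then show "(fourier (\<lambda>x. (- \<i> * of_real x) ^ n * u x) has_vector_derivative
      fourier (\<lambda>x. (- \<i> * of_real x) ^ Suc n * u x) \<xi>) (at \<xi>)"
    by (simp add: mult.assoc)
qed simp

subsection \<open>Paley-Wiener theorems\<close>

lemma integral_window_limit:
  fixes f :: "real \<Rightarrow> complex"
  assumes "integrable lborel f"
  shows "(\<lambda>n. LINT x|lborel. indicator {- real n..real n} x *\<^sub>R f x) \<longlonglongrightarrow> (LINT x|lborel. f x)"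
proof (rule integral_dominated_convergence[where w="\<lambda>x. norm (f x)"])
  show "f \<in> borel_measurable lborel" "integrable lborel (\<lambda>x. norm (f x))"
    using assms by auto
  then show "(\<lambda>x. indicator {- real n..real n} x *\<^sub>R f x) \<in> borel_measurable lborel" for n
    by (intro borel_measurable_scaleR) auto
  show "AE x in lborel. (\<lambda>n. indicator {- real n..real n} x *\<^sub>R f x) \<longlonglongrightarrow> f x"
  proof (intro AE_I2 tendsto_eventually)
    fix x
    have "eventually (\<lambda>n. \<bar>x\<bar> \<le> real n) sequentially"
      using filterlim_real_sequentially by (simp add: filterlim_at_top)
    then show "eventually (\<lambda>n. indicator {- real n..real n} x *\<^sub>R f x = f x) sequentially"
      by eventually_elim (auto simp: indicator_def)
  qed
qed (auto simp: indicator_def)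

text \<open>Cauchy's theorem for the rectangle over \<open>{- n..n}\<close>, expressed by a
  primitive \<open>P\<close>: the integrals over the two horizontal sides differ by the increments
  of \<open>P\<close> along the vertical sides, and the decay of \<open>G\<close> makes these vanish
  as \<open>n\<close> grows.\<close>

lemma horizontal_contour_shift:
  assumes G: "G holomorphic_on UNIV"
    and bd: "\<And>z. \<bar>Im z\<bar> \<le> \<bar>\<eta>\<bar> \<Longrightarrow> norm (G z) \<le> C / (1 + \<bar>Re z\<bar>)\<^sup>2"
  shows "(LINT x|lborel. G (Complex x \<eta>)) = (LINT x|lborel. G (of_real x))"
proof -
  obtain P where P: "\<And>z. (P has_field_derivative G z) (at z)"
    using holomorphic_convex_primitive'[OF convex_UNIV open_UNIV G] by auto
  have contG: "continuous_on S G" for S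
    using G holomorphic_on_imp_continuous_on holomorphic_on_subset by blast
  have cont: "continuous_on S (\<lambda>x. G (Complex x t))" for S t
    unfolding Complex_eq by (intro continuous_on_compose2[OF contG[of UNIV]] continuous_intros) auto
  have int: "integrable lborel (\<lambda>x. G (Complex x t))" if "\<bar>t\<bar> \<le> \<bar>\<eta>\<bar>" for t
  proof (rule integrable_decay)
    show "(\<lambda>x. G (Complex x t)) \<in> borel_measurable borel"
      using cont by (rule borel_measurable_continuous_onI)
    show "norm (G (Complex x t)) \<le> C / (1 + \<bar>x\<bar>)\<^sup>2" for x
      using bd[of "Complex x t"] that by simp
  qed
  have FTC: "(LINT x|lborel. indicator {- real n..real n} x *\<^sub>R G (Complex x t))
      = P (Complex (real n) t) - P (Complex (- real n) t)" for n t
  proof (rule integral_FTC_Icc)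
    fix x
    have "((\<lambda>x. complex_of_real x + \<i> * of_real t) has_vector_derivative 1) (at x within {- real n..real n})"
      by (auto intro!: derivative_eq_intros)
    from field_vector_diff_chain_within[OF this has_field_derivative_at_within[OF P]]
    show "((\<lambda>x. P (Complex x t)) has_vector_derivative G (Complex x t)) (at x within {- real n..real n})"
      by (simp add: o_def Complex_eq)
  qed (auto intro: cont)
  have side: "norm (P (Complex x \<eta>) - P (Complex x 0)) \<le> C / (1 + \<bar>x\<bar>)\<^sup>2 * \<bar>\<eta>\<bar>" for x
  proof -
    have "norm (P (Complex x \<eta>) - P (Complex x 0)) \<le> C / (1 + \<bar>x\<bar>)\<^sup>2 * norm (Complex x \<eta> - Complex x 0)"
    proof (rule field_differentiable_bound[OF convex_closed_segment])
      fix z assume "z \<in> closed_segment (Complex x 0) (Complex x \<eta>)"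
      then obtain s where s: "0 \<le> s" "s \<le> 1" and z: "z = (1 - s) *\<^sub>R Complex x 0 + s *\<^sub>R Complex x \<eta>"
        unfolding closed_segment_def by blast
      have "Re z = x" "Im z = s * \<eta>"
        unfolding z by (simp_all add: algebra_simps)
      then have "Re z = x" "\<bar>Im z\<bar> \<le> \<bar>\<eta>\<bar>"
        using s by (auto simp: abs_mult mult_left_le_one_le)
      then show "norm (G z) \<le> C / (1 + \<bar>x\<bar>)\<^sup>2"
        using bd by auto
    qed (auto intro: has_field_derivative_at_within[OF P])
    then show ?thesis
      by (simp add: cmod_def)
  qed
  let ?I = "\<lambda>t n. LINT x|lborel. indicator {- real n..real n} x *\<^sub>R G (Complex x t)"
  have "(\<lambda>n. ?I \<eta> n - ?I 0 n) \<longlonglongrightarrow> (LINT x|lborel. G (Complex x \<eta>)) - (LINT x|lborel. G (Complex x 0))"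
    using int by (intro tendsto_diff integral_window_limit) auto
  moreover have "(\<lambda>n. ?I \<eta> n - ?I 0 n) \<longlonglongrightarrow> 0"
  proof (rule Lim_null_comparison)
    show "\<forall>\<^sub>F n in sequentially. norm (?I \<eta> n - ?I 0 n) \<le> 2 * (C / (1 + real n)\<^sup>2 * \<bar>\<eta>\<bar>)"
    proof (intro always_eventually allI)
      fix n
      have "?I \<eta> n - ?I 0 n = (P (Complex (real n) \<eta>) - P (Complex (real n) 0))
          - (P (Complex (- real n) \<eta>) - P (Complex (- real n) 0))"
        by (simp add: FTC)
      also have "norm \<dots> \<le> norm (P (Complex (real n) \<eta>) - P (Complex (real n) 0))
          + norm (P (Complex (- real n) \<eta>) - P (Complex (- real n) 0))"
        by (rule norm_triangle_ineq4)
      also have "\<dots> \<le> C / (1 + real n)\<^sup>2 * \<bar>\<eta>\<bar> + C / (1 + real n)\<^sup>2 * \<bar>\<eta>\<bar>"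
        using side[of "real n"] side[of "- real n"] by (intro add_mono) auto
      finally show "norm (?I \<eta> n - ?I 0 n) \<le> 2 * (C / (1 + real n)\<^sup>2 * \<bar>\<eta>\<bar>)"
        by simp
    qed
    show "(\<lambda>n. 2 * (C / (1 + real n)\<^sup>2 * \<bar>\<eta>\<bar>)) \<longlonglongrightarrow> 0"
      by real_asymp
  qed
  ultimately have "(LINT x|lborel. G (Complex x \<eta>)) - (LINT x|lborel. G (Complex x 0)) = 0"
    using LIMSEQ_unique by blast
  then show ?thesis
    by (simp add: complex_of_real_def)
qed

text \<open>The support lies in \<open>{- r..r}\<close>. For \<open>\<xi>\<close> outside, moving
  the line of integration by \<open>s\<close> in the imaginary direction gains the factor
  \<open>exp (- s * (\<bar>\<xi>\<bar> - r))\<close>, and \<open>s\<close> is arbitrary.\<close>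

lemma fourier_in_test_space:
  assumes u: "u \<in> Z_space"
  shows "fourier u \<in> test_space"
proof -
  obtain E r where E: "E holomorphic_on UNIV" "\<And>x. E (of_real x) = u x" "r > 0"
    "\<And>n::nat. \<exists>C\<ge>0. \<forall>z. norm (E z) \<le> C / (1 + norm z) ^ n * exp (r * \<bar>Im z\<bar>)"
    by (rule Z_spaceE[OF u]) blast
  obtain C where C: "C \<ge> 0" "\<And>z. norm (E z) \<le> C / (1 + norm z)\<^sup>2 * exp (r * \<bar>Im z\<bar>)"
    using E(4) by blast
  have E_bd: "norm (E z) \<le> C / (1 + \<bar>Re z\<bar>)\<^sup>2 * exp (r * \<bar>Im z\<bar>)" for z
  proof -
    have "C / (1 + norm z)\<^sup>2 \<le> C / (1 + \<bar>Re z\<bar>)\<^sup>2"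
      using C(1) abs_Re_le_cmod[of z]
      by (intro divide_left_mono power_mono mult_pos_pos zero_less_power) (auto simp: add_pos_nonneg)
    then show ?thesis
      using C(2)[of z] by (meson exp_ge_zero mult_right_mono order_trans)
  qed
  show ?thesis
  proof (rule test_spaceI[OF smooth_fourier[OF u]])
    fix \<xi> assume \<xi>: "r < \<bar>\<xi>\<bar>"
    define G where "G z = E z * exp (- (\<i> * z * of_real \<xi>))" for z
    define K where "K = (LINT x|lborel. C / (1 + \<bar>x\<bar>)\<^sup>2)"
    have int: "integrable lborel (\<lambda>x::real. C / (1 + \<bar>x\<bar>)\<^sup>2)"
    proof -
      have "integrable lborel (\<lambda>x::real. complex_of_real (C / (1 + \<bar>x\<bar>)\<^sup>2))"
        using C(1) by (intro integrable_decay[where C=C]) (simp_all only: norm_of_real, auto)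
      then show ?thesis
        by (simp only: complex_of_real_integrable_eq)
    qed
    have "K \<ge> 0"
      unfolding K_def using C(1) by simp
    have G_bd: "norm (G z) \<le> C / (1 + \<bar>Re z\<bar>)\<^sup>2 * exp (r * \<bar>Im z\<bar> + Im z * \<xi>)" for z
    proof -
      have "norm (G z) = norm (E z) * exp (Im z * \<xi>)"
        by (simp add: G_def norm_mult norm_exp_eq_Re)
      also have "\<dots> \<le> C / (1 + \<bar>Re z\<bar>)\<^sup>2 * exp (r * \<bar>Im z\<bar>) * exp (Im z * \<xi>)"
        using E_bd by (intro mult_right_mono) auto
      finally show ?thesis by (simp add: exp_add)
    qed
    let ?I = "LINT x|lborel. G (of_real x)"
    \<comment> \<open>A linear lower bound for the exponential suffices here and replaces the limit
      of large \<open>s\<close>.\<close>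
    have "norm ?I * (1 + s * (\<bar>\<xi>\<bar> - r)) \<le> K" if s: "s \<ge> 0" for s
    proof -
      \<comment> \<open>The exponential in \<open>G\<close> has modulus
        \<open>exp (Im z * \<xi>)\<close>, so the line is moved to the side where
        \<open>Im z * \<xi>\<close> is negative.\<close>
      define \<eta> where "\<eta> = - s * sgn \<xi>"
      have \<eta>: "\<bar>\<eta>\<bar> = s" "\<eta> * \<xi> = - s * \<bar>\<xi>\<bar>"
        using s \<xi> E(3) by (auto simp: \<eta>_def abs_mult sgn_if)
      have "?I = (LINT x|lborel. G (Complex x \<eta>))"
      proof (rule horizontal_contour_shift[symmetric])
        show "G holomorphic_on UNIV"
          unfolding G_def by (intro holomorphic_intros E(1))
        fix z assume z: "\<bar>Im z\<bar> \<le> \<bar>\<eta>\<bar>"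
        have "Im z * \<xi> \<le> \<bar>Im z\<bar> * \<bar>\<xi>\<bar>"
          by (metis abs_ge_self abs_mult)
        also have "\<dots> \<le> \<bar>\<eta>\<bar> * \<bar>\<xi>\<bar>"
          using z by (intro mult_right_mono) auto
        finally have "Im z * \<xi> \<le> \<bar>\<eta>\<bar> * \<bar>\<xi>\<bar>" .
        then have "r * \<bar>Im z\<bar> + Im z * \<xi> \<le> r * \<bar>\<eta>\<bar> + \<bar>\<eta>\<bar> * \<bar>\<xi>\<bar>"
          using z E(3) by (intro add_mono mult_left_mono) auto
        then have "C / (1 + \<bar>Re z\<bar>)\<^sup>2 * exp (r * \<bar>Im z\<bar> + Im z * \<xi>)
            \<le> C / (1 + \<bar>Re z\<bar>)\<^sup>2 * exp (r * \<bar>\<eta>\<bar> + \<bar>\<eta>\<bar> * \<bar>\<xi>\<bar>)"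
          using C(1) by (intro mult_left_mono) auto
        with G_bd[of z] show "norm (G z) \<le> (C * exp (r * \<bar>\<eta>\<bar> + \<bar>\<eta>\<bar> * \<bar>\<xi>\<bar>)) / (1 + \<bar>Re z\<bar>)\<^sup>2"
          by simp
      qed
      also have "norm \<dots> \<le> (LINT x|lborel. C / (1 + \<bar>x\<bar>)\<^sup>2 * exp (s * (r - \<bar>\<xi>\<bar>)))"
      proof (rule order_trans[OF integral_norm_bound integral_mono])
        have "(\<lambda>x. G (Complex x \<eta>)) \<in> borel_measurable borel"
          unfolding Complex_eq G_def using E(1)
          by (intro borel_measurable_continuous_onI continuous_intros
              continuous_on_compose2[OF holomorphic_on_imp_continuous_on[OF E(1)]]) auto
        then show "integrable lborel (\<lambda>x. norm (G (Complex x \<eta>)))"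
          using G_bd[of "Complex _ \<eta>"]
          by (intro integrable_norm integrable_decay[where C="C * exp (r * \<bar>\<eta>\<bar> + \<eta> * \<xi>)"]) auto
        show "integrable lborel (\<lambda>x. C / (1 + \<bar>x\<bar>)\<^sup>2 * exp (s * (r - \<bar>\<xi>\<bar>)))"
          by (intro integrable_mult_left int)
        show "norm (G (Complex x \<eta>)) \<le> C / (1 + \<bar>x\<bar>)\<^sup>2 * exp (s * (r - \<bar>\<xi>\<bar>))" for x
          using G_bd[of "Complex x \<eta>"] \<eta> by (simp add: algebra_simps)
      qed
      also have "\<dots> = K * exp (s * (r - \<bar>\<xi>\<bar>))"
        by (simp only: K_def integral_mult_left_zero)
      finally have "norm ?I * exp (s * (\<bar>\<xi>\<bar> - r)) \<le> K * exp (s * (r - \<bar>\<xi>\<bar>)) * exp (s * (\<bar>\<xi>\<bar> - r))"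
        by (intro mult_right_mono) auto
      also have "\<dots> = K * exp (s * (r - \<bar>\<xi>\<bar>) + s * (\<bar>\<xi>\<bar> - r))"
        by (simp only: exp_add mult.assoc)
      also have "\<dots> = K"
        by (simp add: algebra_simps)
      finally have "norm ?I * exp (s * (\<bar>\<xi>\<bar> - r)) \<le> K" .
      moreover have "norm ?I * (1 + s * (\<bar>\<xi>\<bar> - r)) \<le> norm ?I * exp (s * (\<bar>\<xi>\<bar> - r))"
        by (intro mult_left_mono exp_ge_add_one_self) auto
      ultimately show ?thesis by linarith
    qed
    \<comment> \<open>If \<open>norm ?I\<close> were nonzero, this \<open>s\<close> would make the
      left-hand side \<open>norm ?I + K\<close>, which exceeds \<open>K\<close>.\<close>
    from this[of "K / (norm ?I * (\<bar>\<xi>\<bar> - r))"]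
    have "norm ?I = 0"
      using \<xi> \<open>K \<ge> 0\<close> by (cases "norm ?I = 0") (auto simp: field_simps)
    then show "fourier u \<xi> = 0"
      by (simp add: fourier_def G_def E(2))
  qed
qed


section \<open>Entire extensions of transforms of test functions\<close>

lemma nderiv_outside_support:
  assumes g: "smooth g" "\<And>x. R < \<bar>x\<bar> \<Longrightarrow> g x = 0" and x: "R < \<bar>x\<bar>"
  shows "nderiv n g x = 0"
  using x
proof (induction n arbitrary: x)
  case (Suc n)
  have "open {y. R < \<bar>y\<bar>}"
    by (intro open_Collect_less continuous_intros)
  then have "((\<lambda>_. 0) has_vector_derivative nderiv (Suc n) g x) (at x)"
    using Suc by (intro has_vector_derivative_transform_within_open[OF smooth_has_vector_derivative[OF g(1), of n]]) auto
  then show ?case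
    using has_vector_derivative_const vector_derivative_unique_at by blast
qed (use g in simp)

lemma integral_compact_support:
  fixes f :: "real \<Rightarrow> complex"
  assumes "continuous_on UNIV f" "\<And>x. R < \<bar>x\<bar> \<Longrightarrow> f x = 0"
  shows "integrable lborel f" and "(LINT x|lborel. f x) = integral {-R..R} f"
proof -
  have eq: "(\<lambda>x. indicator {-R..R} x *\<^sub>R f x) = f"
    using assms(2) by (auto simp: fun_eq_iff indicator_def abs_le_iff not_le[symmetric])
  have *: "set_integrable lborel {-R..R} f"
    by (rule borel_integrable_atLeastAtMost') (rule continuous_on_subset[OF assms(1) subset_UNIV])
  from * show "integrable lborel f"
    by (simp only: set_integrable_def eq)
  from set_borel_integral_eq_integral(2)[OF *]
  show "(LINT x|lborel. f x) = integral {-R..R} f"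
    by (simp only: set_lebesgue_integral_def eq)
qed

lemma test_space_integrable:
  assumes "g \<in> test_space"
  shows "integrable lborel g"
proof -
  obtain R where "\<And>x. R < \<bar>x\<bar> \<Longrightarrow> g x = 0"
    using test_spaceE[OF assms] by blast
  then show ?thesis
    using smooth_continuous[of g UNIV 0] assms
    by (intro integral_compact_support) (auto simp: test_space_def)
qed

lemma test_space_continuous: "g \<in> test_space \<Longrightarrow> continuous_on S g"
  using smooth_continuous[of g S 0] by (simp add: test_space_def)

text \<open>Up to the factor \<open>1 / sqrt (2 * pi)\<close>, the entire extension of
  \<open>fourier_adj g\<close>.\<close>

definition fourier_laplace :: "(real \<Rightarrow> complex) \<Rightarrow> complex \<Rightarrow> complex" where
  "fourier_laplace g z = (LINT \<xi>|lborel. g \<xi> * exp (\<i> * z * of_real \<xi>))"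

lemma fourier_laplace_by_parts:
  assumes g: "smooth g" "\<And>x. R < \<bar>x\<bar> \<Longrightarrow> g x = 0"
  shows "z * fourier_laplace g z = \<i> * fourier_laplace (nderiv 1 g) z"
proof -
  let ?e = "\<lambda>\<xi>. exp (\<i> * z * complex_of_real \<xi>)"
  let ?f = "\<lambda>\<xi>. g \<xi> * (\<i> * z * ?e \<xi>) + nderiv 1 g \<xi> * ?e \<xi>"
  \<comment> \<open>\<open>R\<close> may be negative, and \<open>g\<close> is known to vanish only
    strictly beyond \<open>R\<close>. A positive \<open>S\<close> larger than \<open>R\<close> makes
    \<open>{-S..S}\<close> a proper interval at whose ends the boundary terms vanish.\<close>
  define S where "S = max R 0 + 1"
  have S: "S > 0" "R < S" by (auto simp: S_def)
  have supp: "S < \<bar>x\<bar> \<Longrightarrow> nderiv n g x = 0" for n x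
    using S by (intro nderiv_outside_support[OF g]) auto
  then have supp': "x \<notin> {-S..S} \<Longrightarrow> nderiv n g x = 0" for n x
    by (auto simp: abs_less_iff)
  have cont: "continuous_on UNIV (\<lambda>\<xi>. nderiv n g \<xi> * ?e \<xi>)" for n
    by (intro continuous_intros smooth_continuous[OF g(1)])
  have int: "integrable lborel (\<lambda>\<xi>. nderiv n g \<xi> * ?e \<xi>)" for n
    using supp by (intro integral_compact_support(1)[where R=S] cont) auto
  have "?f = (\<lambda>\<xi>. indicator {-S..S} \<xi> *\<^sub>R ?f \<xi>)"
    using supp'[of _ 0] supp'[of _ 1] by (auto simp: fun_eq_iff indicator_def)
  then have "(LINT \<xi>|lborel. ?f \<xi>) = (LINT \<xi>|lborel. indicator {-S..S} \<xi> *\<^sub>R ?f \<xi>)"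
    by (rule arg_cong)
  also have "\<dots> = g S * ?e S - g (-S) * ?e (-S)"
  proof (rule integral_FTC_Icc)
    fix \<xi>
    have "((\<lambda>\<xi>. \<i> * z * complex_of_real \<xi>) has_vector_derivative \<i> * z) (at \<xi>)"
      by (auto intro!: derivative_eq_intros)
    from field_vector_diff_chain_at[OF this DERIV_exp]
    have "(?e has_vector_derivative \<i> * z * ?e \<xi>) (at \<xi>)"
      by (simp add: o_def)
    from has_vector_derivative_mult[OF smooth_has_vector_derivative[OF g(1), of 0 \<xi>] this]
    show "((\<lambda>\<xi>. g \<xi> * ?e \<xi>) has_vector_derivative ?f \<xi>) (at \<xi> within {-S..S})"
      by (simp add: has_vector_derivative_at_within)
    show "continuous_on {-S..S} ?f"
      using smooth_continuous[OF g(1), of _ 0]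
      by (intro continuous_intros smooth_continuous[OF g(1)]) auto
  qed (use S in auto)
  also have "\<dots> = 0"
    using g(2)[of S] g(2)[of "-S"] S by simp
  finally have "0 = (LINT \<xi>|lborel. \<i> * z * (nderiv 0 g \<xi> * ?e \<xi>) + nderiv 1 g \<xi> * ?e \<xi>)"
    by (simp add: mult_ac)
  also have "\<dots> = \<i> * z * fourier_laplace g z + fourier_laplace (nderiv 1 g) z"
    using int[of 0] int[of 1] unfolding fourier_laplace_def
    by (subst Bochner_Integration.integral_add) auto
  finally have "\<i> * (\<i> * z * fourier_laplace g z + fourier_laplace (nderiv 1 g) z) = 0"
    by simp
  then show ?thesis
    by (simp add: algebra_simps)
qed

lemma fourier_laplace_power:
  assumes g: "smooth g" "\<And>x. R < \<bar>x\<bar> \<Longrightarrow> g x = 0"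
  shows "z ^ n * fourier_laplace g z = \<i> ^ n * fourier_laplace (nderiv n g) z"
proof (induction n)
  case (Suc n)
  have "z * fourier_laplace (nderiv n g) z = \<i> * fourier_laplace (nderiv (Suc n) g) z"
    using fourier_laplace_by_parts[OF smooth_nderiv[OF g(1)] nderiv_outside_support[OF g], where z=z]
    by (simp add: nderiv_Suc)
  with Suc show ?case
    by (simp add: mult_ac)
qed simp

text \<open>The exponential type is the radius of the support, since the kernel has modulus
  \<open>exp (- (Im z * \<xi>))\<close>.\<close>

lemma fourier_laplace_bound:
  assumes g: "continuous_on UNIV g" "\<And>x. R < \<bar>x\<bar> \<Longrightarrow> g x = 0" and R: "R > 0"
  obtains C where "C \<ge> 0" "\<And>z. norm (fourier_laplace g z) \<le> C * exp (R * \<bar>Im z\<bar>)"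
proof -
  let ?C = "LINT \<xi>|lborel. norm (g \<xi>)"
  have int: "integrable lborel g"
    by (rule integral_compact_support[OF g])
  have "norm (fourier_laplace g z) \<le> ?C * exp (R * \<bar>Im z\<bar>)" for z
  proof -
    have "norm (fourier_laplace g z) \<le> (LINT \<xi>|lborel. norm (g \<xi>) * exp (R * \<bar>Im z\<bar>))"
      unfolding fourier_laplace_def
    proof (rule order_trans[OF integral_norm_bound integral_mono])
      show "integrable lborel (\<lambda>\<xi>. norm (g \<xi> * exp (\<i> * z * of_real \<xi>)))"
        using g by (intro integrable_norm integral_compact_support(1)[where R=R] continuous_intros) auto
      show "integrable lborel (\<lambda>\<xi>. norm (g \<xi>) * exp (R * \<bar>Im z\<bar>))"
        using int by simp
      fix \<xi>
      show "norm (g \<xi> * exp (\<i> * z * of_real \<xi>)) \<le> norm (g \<xi>) * exp (R * \<bar>Im z\<bar>)"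
      proof (cases "\<bar>\<xi>\<bar> \<le> R")
        case True
        have "- (Im z * \<xi>) \<le> \<bar>\<xi>\<bar> * \<bar>Im z\<bar>"
          by (metis abs_ge_minus_self abs_mult mult.commute)
        also have "\<dots> \<le> R * \<bar>Im z\<bar>"
          using True by (intro mult_right_mono) auto
        finally show ?thesis
          by (simp add: norm_mult norm_exp_eq_Re mult_left_mono)
      qed (use g(2) in auto)
    qed
    then show ?thesis by simp
  qed
  moreover have "?C \<ge> 0" by simp
  ultimately show ?thesis using that by blast
qed

lemma holomorphic_fourier_laplace:
  assumes g: "continuous_on UNIV g" "\<And>x. R < \<bar>x\<bar> \<Longrightarrow> g x = 0"
  shows "fourier_laplace g holomorphic_on UNIV"
proof -
  let ?f = "\<lambda>z \<xi>. g \<xi> * exp (\<i> * z * complex_of_real \<xi>)"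
  have cont: "continuous_on S (\<lambda>x. g (h x))" if "continuous_on S h" for S :: "'a::topological_space set" and h
    using continuous_on_compose2[OF g(1) that] by simp
  have "(\<lambda>z. integral (cbox (-R) R) (?f z)) holomorphic_on UNIV"
  proof (rule leibniz_rule_holomorphic)
    show "((\<lambda>z. ?f z \<xi>) has_field_derivative g \<xi> * (exp (\<i> * z * of_real \<xi>) * (\<i> * of_real \<xi>))) (at z within UNIV)" for z \<xi>
      by (auto intro!: derivative_eq_intros)
    show "?f z integrable_on cbox (-R) R" for z
      by (intro integrable_continuous continuous_intros cont)
    show "continuous_on (UNIV \<times> cbox (-R) R)
        (\<lambda>(z, \<xi>). g \<xi> * (exp (\<i> * z * of_real \<xi>) * (\<i> * of_real \<xi>)))"
      unfolding case_prod_beta by (intro continuous_intros cont)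
  qed simp
  moreover have "integral (cbox (-R) R) (?f z) = fourier_laplace g z" for z
    unfolding fourier_laplace_def using g
    by (subst integral_compact_support(2)[where R=R]) (auto intro!: continuous_intros cont)
  ultimately show ?thesis by simp
qed

text \<open>Integrating by parts \<open>n\<close> times trades the power \<open>z ^ n\<close> for
  the \<open>n\<close>-th derivative of \<open>g\<close>, whose support is no larger. Hence decay of
  every order holds with one exponential type.\<close>

lemma fourier_adj_in_Z_space:
  assumes g: "g \<in> test_space"
  shows "fourier_adj g \<in> Z_space"
proof -
  obtain R where R: "R > 0" "\<And>x. R < \<bar>x\<bar> \<Longrightarrow> g x = 0"
    using test_spaceE[OF g] by blast
  have sm: "smooth g" using g by (simp add: test_space_def)
  let ?c = "complex_of_real (1 / sqrt (2 * pi))"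
  show ?thesis
  proof (rule Z_spaceI[where E="\<lambda>z. ?c * fourier_laplace g z" and r=R])
    show "(\<lambda>z. ?c * fourier_laplace g z) holomorphic_on UNIV"
      by (intro holomorphic_intros holomorphic_fourier_laplace[OF test_space_continuous[OF g] R(2)])
    show "?c * fourier_laplace g (of_real x) = fourier_adj g x" for x
      by (simp add: fourier_laplace_def fourier_adj_def)
    show "R > 0" by fact
    fix n :: nat
    obtain C where C: "C \<ge> 0" "\<And>z. norm (fourier_laplace g z) \<le> C * exp (R * \<bar>Im z\<bar>)"
      using fourier_laplace_bound[OF test_space_continuous[OF g] R(2) R(1)] by blast
    obtain D where D: "D \<ge> 0" "\<And>z. norm (fourier_laplace (nderiv n g) z) \<le> D * exp (R * \<bar>Im z\<bar>)"
      using fourier_laplace_bound[OF smooth_continuous[OF sm] _ R(1)] nderiv_outside_support[OF sm R(2)] by blast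
    have "norm (?c * fourier_laplace g z) \<le> (norm ?c * 2 ^ n * (C + D)) / (1 + norm z) ^ n * exp (R * \<bar>Im z\<bar>)" for z
    proof -
      \<comment> \<open>Reduces the decay of order \<open>n\<close> to two bounds of the same kind,
        one for \<open>g\<close> and one for its \<open>n\<close>-th derivative.\<close>
      have "(1 + norm z) ^ n \<le> 2 ^ n * (1 + norm z ^ n)"
      proof (cases "norm z \<le> 1")
        case True
        then have "(1 + norm z) ^ n \<le> 2 ^ n"
          by (intro power_mono) auto
        also have "\<dots> \<le> 2 ^ n * (1 + norm z ^ n)" by simp
        finally show ?thesis .
      next
        case False
        then have "(1 + norm z) ^ n \<le> (2 * norm z) ^ n"
          by (intro power_mono) auto
        also have "\<dots> \<le> 2 ^ n * (1 + norm z ^ n)"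
          by (simp add: power_mult_distrib)
        finally show ?thesis .
      qed
      then have "(1 + norm z) ^ n * norm (fourier_laplace g z)
          \<le> 2 ^ n * (1 + norm z ^ n) * norm (fourier_laplace g z)"
        by (intro mult_right_mono) auto
      also have "\<dots> = 2 ^ n * (norm (fourier_laplace g z) + norm (z ^ n * fourier_laplace g z))"
        by (simp add: norm_mult norm_power algebra_simps)
      also have "norm (z ^ n * fourier_laplace g z) = norm (fourier_laplace (nderiv n g) z)"
        using arg_cong[where f=norm, OF fourier_laplace_power[OF sm R(2), where z=z and n=n]]
        by (simp add: norm_mult norm_power)
      also have "2 ^ n * (norm (fourier_laplace g z) + norm (fourier_laplace (nderiv n g) z))
          \<le> 2 ^ n * (C * exp (R * \<bar>Im z\<bar>) + D * exp (R * \<bar>Im z\<bar>))"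
        using C D by (intro mult_left_mono add_mono) auto
      finally have "(1 + norm z) ^ n * norm (fourier_laplace g z) \<le> 2 ^ n * (C + D) * exp (R * \<bar>Im z\<bar>)"
        by (simp only: algebra_simps)
      moreover have "(1 + norm z) ^ n > 0"
        by (simp add: add_pos_nonneg)
      ultimately have "norm (fourier_laplace g z) \<le> 2 ^ n * (C + D) * exp (R * \<bar>Im z\<bar>) / (1 + norm z) ^ n"
        by (simp add: le_divide_eq mult.commute)
      from mult_left_mono[OF this norm_ge_zero[of ?c]]
      show ?thesis
        by (simp only: norm_mult times_divide_eq_right times_divide_eq_left mult.assoc)
    qed
    then show "\<exists>C. \<forall>z. norm (?c * fourier_laplace g z) \<le> C / (1 + norm z) ^ n * exp (R * \<bar>Im z\<bar>)"
      by blast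
  qed
qed

subsection \<open>Fourier inversion\<close>

text \<open>Serves to exchange Fourier integrals, with \<open>K\<close> an exponential of modulus
  1.\<close>

lemma Fubini_bounded_kernel:
  fixes f g :: "real \<Rightarrow> complex" and K :: "real \<Rightarrow> real \<Rightarrow> complex"
  assumes f: "integrable lborel f" and g: "integrable lborel g"
    and K[measurable]: "(\<lambda>(x, y). K x y) \<in> borel_measurable (borel \<Otimes>\<^sub>M borel)"
    and K_le: "\<And>x y. norm (K x y) \<le> 1"
  shows "(LINT x|lborel. f x * (LINT y|lborel. g y * K x y)) = (LINT y|lborel. g y * (LINT x|lborel. f x * K x y))"
proof -
  have [measurable]: "f \<in> borel_measurable borel" "g \<in> borel_measurable borel"
    using f g by auto
  have K_x: "K x \<in> borel_measurable borel" for x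
    by measurable
  have int_y: "integrable lborel (\<lambda>y. g y * K x y)" for x
    by (rule integrable_mult_bounded[OF g K_x K_le])
  have "integrable (lborel \<Otimes>\<^sub>M lborel) (\<lambda>(x, y). f x * (g y * K x y))"
  proof (rule lborel_pair.Fubini_integrable)
    show "(\<lambda>(x, y). f x * (g y * K x y)) \<in> borel_measurable (lborel \<Otimes>\<^sub>M lborel)"
      by measurable
    show "AE x in lborel. integrable lborel (\<lambda>y. case (x, y) of (x, y) \<Rightarrow> f x * (g y * K x y))"
      using int_y by simp
    show "integrable lborel (\<lambda>x. LINT y|lborel. norm (case (x, y) of (x, y) \<Rightarrow> f x * (g y * K x y)))"
    proof (rule Bochner_Integration.integrable_bound)
      show "integrable lborel (\<lambda>x. norm (f x) * (LINT y|lborel. norm (g y)))"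
        using f by simp
      show "(\<lambda>x. LINT y|lborel. norm (case (x, y) of (x, y) \<Rightarrow> f x * (g y * K x y))) \<in> borel_measurable lborel"
        by measurable
      have "(LINT y|lborel. norm (f x * (g y * K x y))) \<le> norm (f x) * (LINT y|lborel. norm (g y))" for x
      proof -
        have "(LINT y|lborel. norm (g y * K x y)) \<le> (LINT y|lborel. norm (g y))"
          using g K_le by (intro integral_mono integrable_norm[OF int_y]) (auto simp: norm_mult mult_left_le)
        then show ?thesis
          by (simp add: norm_mult[of "f x"] mult_left_mono)
      qed
      then show "AE x in lborel. norm (LINT y|lborel. norm (case (x, y) of (x, y) \<Rightarrow> f x * (g y * K x y)))
          \<le> norm (norm (f x) * (LINT y|lborel. norm (g y)))"
        by (auto simp: abs_of_nonneg)
    qed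
  qed
  from lborel_pair.Fubini_integral[OF this]
  have "(LINT y|lborel. LINT x|lborel. g y * (f x * K x y)) = (LINT x|lborel. LINT y|lborel. f x * (g y * K x y))"
    by (simp add: mult.left_commute)
  then show ?thesis
    by (simp only: integral_mult_right_zero)
qed

lemma integrable_gaussian: "integrable lborel (\<lambda>x::real. complex_of_real (exp (- x\<^sup>2 / 2)))"
proof -
  have "integrable lborel (\<lambda>x. sqrt (2 * pi) * std_normal_density x)"
    by simp
  then show ?thesis
    unfolding std_normal_density_def complex_of_real_integrable_eq by simp
qed

text \<open>This is the characteristic function of the standard normal distribution, freed of its
  normalising constant.\<close>

lemma integral_gaussian_exp:
  "(LINT x|lborel. complex_of_real (exp (- x\<^sup>2 / 2)) * exp (\<i> * of_real t * of_real x))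
     = of_real (sqrt (2 * pi)) * of_real (exp (- t\<^sup>2 / 2))"
proof -
  have "complex_of_real (exp (- t\<^sup>2 / 2)) = char std_normal_distribution t"
    by (simp add: char_std_normal_distribution)
  also have "\<dots> = (LINT x|lborel. std_normal_density x *\<^sub>R iexp (t * x))"
    unfolding char_def by (rule integral_density) auto
  also have "\<dots> = (LINT x|lborel. of_real (1 / sqrt (2 * pi)) * (complex_of_real (exp (- x\<^sup>2 / 2)) * exp (\<i> * of_real t * of_real x)))"
    by (simp add: std_normal_density_def scaleR_conv_of_real mult_ac)
  also have "\<dots> = of_real (1 / sqrt (2 * pi)) * (LINT x|lborel. complex_of_real (exp (- x\<^sup>2 / 2)) * exp (\<i> * of_real t * of_real x))"
    by (rule integral_mult_right_zero)
  finally show ?thesis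
    by (simp add: field_simps flip: of_real_mult)
qed

text \<open>Gaussian summation. A Gaussian of width \<open>m k\<close> is inserted into the
  inversion integral; exchanging the integrals turns it into a Gaussian average of \<open>f\<close>
  near \<open>x\<close>, and both sides converge by dominated convergence. Membership of
  \<open>f\<close> in \<open>Z_space\<close> is not assumed, so that the lemma also applies to
  \<open>log_laplace_conv\<close>.\<close>

lemma fourier_inversion:
  assumes f: "integrable lborel f" "continuous_on UNIV f" "\<And>x. norm (f x) \<le> B"
    and Ff: "integrable lborel (fourier f)"
  shows "fourier_adj (fourier f) = f"
proof
  fix x
  let ?s = "complex_of_real (sqrt (2 * pi))"
  let ?G = "\<lambda>x. complex_of_real (exp (- x\<^sup>2 / 2))"
  \<comment> \<open>The successor keeps the width positive at \<open>k = 0\<close>.\<close>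
  define m where "m k = real (Suc k)" for k
  have m: "m k > 0" for k by (simp add: m_def)
  have m_lim: "filterlim m at_top sequentially"
    unfolding m_def by real_asymp
  have f_meas[measurable]: "f \<in> borel_measurable borel" and [measurable]: "fourier f \<in> borel_measurable borel"
    using f(1) Ff by auto
  have eq: "(LINT \<xi>|lborel. ?G (\<xi> / m k) * (fourier f \<xi> * exp (\<i> * of_real x * of_real \<xi>)))
      = (LINT z|lborel. ?G z * f (x + z / m k))" for k
  proof -
    define p where "p \<xi> = ?G (\<xi> / m k) * exp (\<i> * of_real x * of_real \<xi>)" for \<xi>
    have "integrable lborel (\<lambda>\<xi>. ?G (0 + (1 / m k) * \<xi>))"
      using m[of k] by (intro lborel_integrable_real_affine[OF integrable_gaussian]) auto
    then have p: "integrable lborel p"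
      unfolding p_def by (intro integrable_fourier) simp
    \<comment> \<open>The extra factor \<open>?s\<close> cancels the normalisation inside
      \<open>fourier f\<close>; it returns from the Gaussian integral and is cancelled at the
      end.\<close>
    have "?s * (LINT \<xi>|lborel. ?G (\<xi> / m k) * (fourier f \<xi> * exp (\<i> * of_real x * of_real \<xi>)))
        = (LINT \<xi>|lborel. ?s * (?G (\<xi> / m k) * (fourier f \<xi> * exp (\<i> * of_real x * of_real \<xi>))))"
      by (rule integral_mult_right_zero[symmetric])
    also have "\<dots> = (LINT \<xi>|lborel. p \<xi> * (LINT y|lborel. f y * exp (- (\<i> * of_real y * of_real \<xi>))))"
      by (simp add: p_def fourier_def mult_ac)
    also have "\<dots> = (LINT y|lborel. f y * (LINT \<xi>|lborel. p \<xi> * exp (- (\<i> * of_real y * of_real \<xi>))))"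
      by (rule Fubini_bounded_kernel[OF p f(1)]) auto
    also have "\<dots> = (LINT y|lborel. f y * (of_real (m k) * (?s * ?G (m k * (x - y)))))"
    proof -
      have "(LINT \<xi>|lborel. p \<xi> * exp (- (\<i> * of_real y * of_real \<xi>))) = of_real (m k) * (?s * ?G (m k * (x - y)))" for y
      proof -
        have "(LINT \<xi>|lborel. p \<xi> * exp (- (\<i> * of_real y * of_real \<xi>)))
            = (LINT \<xi>|lborel. ?G (\<xi> / m k) * exp (\<i> * of_real (x - y) * of_real \<xi>))"
          by (simp add: p_def mult.assoc mult_exp_exp) (simp add: algebra_simps)
        also have "\<dots> = of_real (m k) * (LINT \<eta>|lborel. ?G \<eta> * exp (\<i> * of_real (m k * (x - y)) * of_real \<eta>))"
          using m[of k] by (subst lborel_integral_real_affine[where c="m k" and t=0])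
            (simp_all add: scaleR_conv_of_real mult_ac)
        finally show ?thesis
          by (simp only: integral_gaussian_exp)
      qed
      then show ?thesis by simp
    qed
    also have "\<dots> = (LINT z|lborel. ?s * (?G z * f (x + z / m k)))"
    proof -
      have "(m k * (x - (x + (1 / m k) * z)))\<^sup>2 = z\<^sup>2" for z
        using m[of k] by (simp add: algebra_simps)
      then show ?thesis
        using m[of k] by (subst lborel_integral_real_affine[where c="1 / m k" and t=x])
          (simp_all add: scaleR_conv_of_real mult_ac flip: integral_mult_right_zero)
    qed
    also have "\<dots> = ?s * (LINT z|lborel. ?G z * f (x + z / m k))"
      by (rule integral_mult_right_zero)
    finally show ?thesis
      by simp
  qed
  have "(\<lambda>k. LINT \<xi>|lborel. ?G (\<xi> / m k) * (fourier f \<xi> * exp (\<i> * of_real x * of_real \<xi>)))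
      \<longlonglongrightarrow> (LINT \<xi>|lborel. fourier f \<xi> * exp (\<i> * of_real x * of_real \<xi>))"
  proof (rule integral_dominated_convergence[where w="\<lambda>\<xi>. norm (fourier f \<xi>)"])
    show "AE \<xi> in lborel. (\<lambda>k. ?G (\<xi> / m k) * (fourier f \<xi> * exp (\<i> * of_real x * of_real \<xi>)))
        \<longlonglongrightarrow> fourier f \<xi> * exp (\<i> * of_real x * of_real \<xi>)"
    proof (intro AE_I2)
      fix \<xi>
      have "(\<lambda>k. ?G (\<xi> / m k)) \<longlonglongrightarrow> ?G 0"
        by (intro tendsto_intros tendsto_divide_0[OF tendsto_const] filterlim_at_top_imp_at_infinity m_lim) auto
      from tendsto_mult_right[OF this]
      show "(\<lambda>k. ?G (\<xi> / m k) * (fourier f \<xi> * exp (\<i> * of_real x * of_real \<xi>)))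
          \<longlonglongrightarrow> fourier f \<xi> * exp (\<i> * of_real x * of_real \<xi>)"
        by simp
    qed
    show "AE \<xi> in lborel. norm (?G (\<xi> / m k) * (fourier f \<xi> * exp (\<i> * of_real x * of_real \<xi>)))
        \<le> norm (fourier f \<xi>)" for k
      by (intro AE_I2) (simp add: norm_mult mult_left_le_one_le)
  qed (use Ff in auto)
  moreover have "(\<lambda>k. LINT z|lborel. ?G z * f (x + z / m k)) \<longlonglongrightarrow> (LINT z|lborel. ?G z * f x)"
  proof (rule integral_dominated_convergence[where w="\<lambda>z. norm (?G z) * B"])
    show "AE z in lborel. (\<lambda>k. ?G z * f (x + z / m k)) \<longlonglongrightarrow> ?G z * f x"
    proof (intro AE_I2 tendsto_mult tendsto_const)
      fix z
      have "(\<lambda>k. x + z / m k) \<longlonglongrightarrow> x + 0"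
        by (intro tendsto_intros tendsto_divide_0[OF tendsto_const] filterlim_at_top_imp_at_infinity m_lim)
      then show "(\<lambda>k. f (x + z / m k)) \<longlonglongrightarrow> f x"
        using continuous_on_tendsto_compose[OF f(2)] by simp
    qed
    show "AE z in lborel. norm (?G z * f (x + z / m k)) \<le> norm (?G z) * B" for k
      using f(3) by (intro AE_I2) (simp add: norm_mult mult_left_mono)
    show "integrable lborel (\<lambda>z. norm (?G z) * B)"
      by (intro integrable_mult_left integrable_norm integrable_gaussian)
  qed auto
  ultimately have "(LINT \<xi>|lborel. fourier f \<xi> * exp (\<i> * of_real x * of_real \<xi>)) = (LINT z|lborel. ?G z * f x)"
    unfolding eq using LIMSEQ_unique by blast
  also have "\<dots> = ?s * f x"
    using integral_gaussian_exp[of 0] by simp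
  finally show "fourier_adj (fourier f) x = f x"
    by (simp add: fourier_adj_def)
qed

lemma fourier_inversion_Z: "u \<in> Z_space \<Longrightarrow> fourier_adj (fourier u) = u"
  by (metis Z_space_bounded Z_space_continuous Z_space_integrable fourier_in_test_space
      fourier_inversion test_space_integrable)

text \<open>The two transforms differ by a reflection of the argument. This gives integrability of
  \<open>fourier g\<close> from that of \<open>fourier_adj g\<close>, and turns inversion in one
  order into inversion in the other.\<close>

lemma fourier_inversion_test:
  assumes g: "g \<in> test_space"
  shows "fourier (fourier_adj g) = g"
proof -
  have F: "fourier_adj f (- x) = fourier f x" for f x
    by (simp add: fourier_def fourier_adj_def mult_ac)
  have "integrable lborel (\<lambda>x. fourier_adj g (0 + (-1) * x))"
    by (intro lborel_integrable_real_affine Z_space_integrable fourier_adj_in_Z_space g) simp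
  then have int: "integrable lborel (fourier g)"
    by (simp add: F)
  obtain R where R: "\<And>x. R < \<bar>x\<bar> \<Longrightarrow> g x = 0"
    using test_spaceE[OF g] by blast
  have "compact (g ` {-R..R})"
    by (intro compact_continuous_image test_space_continuous g compact_Icc)
  then obtain B where B: "\<And>x. x \<in> {-R..R} \<Longrightarrow> norm (g x) \<le> B"
    using compact_imp_bounded bounded_iff by (metis imageI)
  have bound: "norm (g x) \<le> max B 0" for x
    using R[of x] B[of x] by (cases "R < \<bar>x\<bar>") (auto simp: not_less abs_le_iff)
  have inv: "fourier_adj (fourier g) = g"
    by (rule fourier_inversion[OF test_space_integrable[OF g] test_space_continuous[OF g] bound int])
  have "fourier (fourier_adj g) \<xi> = fourier_adj (fourier g) \<xi>" for \<xi>
    unfolding fourier_def[of "fourier_adj g"] fourier_adj_def[of "fourier g"]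
    by (subst lborel_integral_real_affine[where c="-1" and t=0]) (simp_all add: F, simp add: mult_ac)
  with inv show ?thesis by auto
qed

subsection \<open>Convolution\<close>

lemma integrable_convolution_integrand:
  fixes f g :: "real \<Rightarrow> complex"
  assumes f: "integrable lborel f" and g: "integrable lborel g"
  shows "integrable (lborel \<Otimes>\<^sub>M lborel) (\<lambda>(s, t). f s * g (t - s))"
proof (rule lborel_pair.Fubini_integrable)
  have [measurable]: "f \<in> borel_measurable borel" "g \<in> borel_measurable borel"
    using f g by auto
  show "(\<lambda>(s, t). f s * g (t - s)) \<in> borel_measurable (lborel \<Otimes>\<^sub>M lborel)"
    by measurable
  have g': "integrable lborel (\<lambda>t. g (t - s))" for s
    using lborel_integrable_real_affine[OF g, of 1 "-s"] by simp
  show "AE s in lborel. integrable lborel (\<lambda>t. case (s, t) of (s, t) \<Rightarrow> f s * g (t - s))"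
    using g' by simp
  have "(LINT t|lborel. norm (g (t - s))) = (LINT t|lborel. norm (g t))" for s
    by (subst (2) lborel_integral_real_affine[where c=1 and t="-s"]) auto
  then show "integrable lborel (\<lambda>s. LINT t|lborel. norm (case (s, t) of (s, t) \<Rightarrow> f s * g (t - s)))"
    using f by (simp add: norm_mult)
qed

text \<open>Once an exponential is absorbed into both functions, this becomes the product rule for
  the Fourier transform as well as for the Laplace transform.\<close>

lemma convolution_integral:
  fixes f g :: "real \<Rightarrow> complex"
  assumes f: "integrable lborel f" and g: "integrable lborel g"
  shows "(LINT t|lborel. LINT s|lborel. f s * g (t - s)) = (LINT s|lborel. f s) * (LINT t|lborel. g t)"
    and "integrable lborel (\<lambda>t. LINT s|lborel. f s * g (t - s))"
proof -
  note int = integrable_convolution_integrand[OF f g]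
  have "(LINT t|lborel. LINT s|lborel. f s * g (t - s)) = (LINT s|lborel. LINT t|lborel. f s * g (t - s))"
    using lborel_pair.Fubini_integral[OF int] .
  also have "\<dots> = (LINT s|lborel. f s * (LINT t|lborel. g t))"
  proof -
    have "(LINT t|lborel. g (t - s)) = (LINT t|lborel. g t)" for s
      by (subst (2) lborel_integral_real_affine[where c=1 and t="-s"]) auto
    then show ?thesis by simp
  qed
  finally show "(LINT t|lborel. LINT s|lborel. f s * g (t - s)) = (LINT s|lborel. f s) * (LINT t|lborel. g t)"
    by simp
  from lborel_pair.integrable_snd[OF int]
  show "integrable lborel (\<lambda>t. LINT s|lborel. f s * g (t - s))" .
qed

subsection \<open>The substitution \<open>t = exp x\<close>\<close>

lemma exp_substitution:
  fixes f :: "real \<Rightarrow> complex"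
  assumes [measurable]: "f \<in> borel_measurable borel" and f0: "\<And>t. t \<le> 0 \<Longrightarrow> f t = 0"
  shows "integrable lborel f \<longleftrightarrow> integrable lborel (\<lambda>x. of_real (exp x) * f (exp x))"
    and "integrable lborel f \<Longrightarrow> (LINT t|lborel. f t) = (LINT x|lborel. of_real (exp x) * f (exp x))"
proof -
  let ?g = "\<lambda>x. of_real (exp x) * f (exp x)"
  have eq: "(\<lambda>t. indicator {0<..} t *\<^sub>R f t) = f"
    using f0 by (auto simp: fun_eq_iff indicator_def not_less)
  \<comment> \<open>The change of variables theorem speaks of the completed Lebesgue measure; for
    Borel functions, integrability and integrals are the same as for \<open>lborel\<close>.\<close>
  have abs_f: "f absolutely_integrable_on {0<..} \<longleftrightarrow> integrable lborel f"
    unfolding set_integrable_def eq by (rule integrable_completion) simp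
  have abs_g: "?g absolutely_integrable_on UNIV \<longleftrightarrow> integrable lborel ?g"
    unfolding set_integrable_def by (simp add: integrable_completion)
  have range_exp: "range exp = {0::real<..}"
  proof (intro equalityI subsetI)
    show "t \<in> range exp" if "t \<in> {0<..}" for t :: real
      using that by (intro image_eqI[of _ exp "ln t"]) auto
  qed auto
  have cv: "?g absolutely_integrable_on UNIV \<and> integral UNIV ?g = b \<longleftrightarrow>
      f absolutely_integrable_on {0<..} \<and> integral {0<..} f = b" for b
    using has_absolute_integral_change_of_variables_real[of UNIV exp exp f b]
    by (simp add: range_exp scaleR_conv_of_real inj_on_def)
  from cv show *: "integrable lborel f \<longleftrightarrow> integrable lborel ?g"
    unfolding abs_f abs_g by blast
  assume f: "integrable lborel f"
  have "integral {0<..} f = (LINT t|lborel. f t)"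
    using set_lebesgue_integral_eq_integral(2)[of "{0<..}" f] f abs_f
    unfolding set_lebesgue_integral_def eq by (simp add: integral_completion)
  moreover have "integral UNIV ?g = (LINT t|lborel. ?g t)"
    using set_lebesgue_integral_eq_integral(2)[of UNIV ?g] f abs_g *
    unfolding set_lebesgue_integral_def by (simp add: integral_completion)
  moreover have "integral UNIV ?g = integral {0<..} f"
    using cv[of "integral {0<..} f"] f abs_f by blast
  ultimately show "(LINT t|lborel. f t) = (LINT x|lborel. ?g x)"
    by simp
qed

subsection \<open>The gamma kernel\<close>

definition gamma_kernel :: "real \<Rightarrow> real \<Rightarrow> complex" where
  "gamma_kernel a x = of_real (exp (- (a * x)) * exp (- exp (- x)))"

lemma gamma_kernel_measurable [measurable]: "gamma_kernel a \<in> borel_measurable borel"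
  unfolding gamma_kernel_def by measurable

text \<open>Euler's integral for Gamma at \<open>z = a + \<i> * \<xi>\<close>, rewritten by
  \<open>t = exp (- x)\<close>; below, \<open>f\<close> is the integrand of Euler's
  integral.\<close>

lemma gamma_kernel_has_fourier_integral:
  assumes a: "a > 0"
  shows "integrable lborel (\<lambda>x. gamma_kernel a x * exp (- (\<i> * of_real x * of_real \<xi>)))"
    and "(LINT x|lborel. gamma_kernel a x * exp (- (\<i> * of_real x * of_real \<xi>))) = Gamma (of_real a + \<i> * of_real \<xi>)"
proof -
  define z where "z = complex_of_real a + \<i> * of_real \<xi>"
  have z: "Re z > 0" using a by (simp add: z_def)
  define f where "f t = (if 0 < t then exp ((z - 1) * of_real (ln t)) * of_real (exp (- t)) else 0)" for t :: real
  have f_meas[measurable]: "f \<in> borel_measurable borel"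
    unfolding f_def by measurable
  have f_eq: "f = (\<lambda>t. indicator {0<..} t *\<^sub>R (complex_of_real t powr (z - 1) / of_real (exp t)))"
    by (auto simp: fun_eq_iff f_def powr_def Ln_of_real exp_minus divide_inverse indicator_def)
  have abs: "(\<lambda>t. complex_of_real t powr (z - 1) / of_real (exp t)) absolutely_integrable_on {0<..}"
    by (rule absolutely_integrable_Gamma_integral'[OF z])
  then have f_int: "integrable lborel f"
    unfolding set_integrable_def f_eq[symmetric] by (subst (asm) integrable_completion) auto
  have "(LINT t|lborel. f t) = (LINT t|lebesgue. f t)"
    by (rule integral_completion[symmetric]) simp
  also have "\<dots> = Gamma z"
    using set_lebesgue_integral_eq_integral(2)[OF abs] Gamma_integral_complex'[OF z]
    unfolding set_lebesgue_integral_def f_eq[symmetric] by (simp add: integral_unique)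
  finally have f_Gamma: "(LINT t|lborel. f t) = Gamma z" .
  have f0: "t \<le> 0 \<Longrightarrow> f t = 0" for t
    by (simp add: f_def)
  have k_eq: "of_real (exp (- x)) * f (exp (- x)) = gamma_kernel a x * exp (- (\<i> * of_real x * of_real \<xi>))" for x
  proof -
    have "of_real (exp (- x)) * f (exp (- x))
        = exp (of_real (- x)) * exp ((z - 1) * of_real (- x)) * of_real (exp (- exp (- x)))"
      by (simp add: f_def flip: exp_of_real)
    also have "exp (of_real (- x)) * exp ((z - 1) * of_real (- x)) = exp (of_real (- (a * x)) + - (\<i> * of_real x * of_real \<xi>))"
      unfolding mult_exp_exp by (simp add: z_def algebra_simps)
    also have "\<dots> = of_real (exp (- (a * x))) * exp (- (\<i> * of_real x * of_real \<xi>))"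
      unfolding exp_add exp_of_real ..
    finally show ?thesis
      by (simp add: gamma_kernel_def mult_ac)
  qed
  have "integrable lborel (\<lambda>x. of_real (exp x) * f (exp x))"
    using exp_substitution(1)[OF f_meas f0] f_int by blast
  \<comment> \<open>\<open>exp_substitution\<close> provides \<open>t = exp x\<close>; the
    reflection of \<open>x\<close> yields the decreasing substitution.\<close>
  then have "integrable lborel (\<lambda>x. of_real (exp (0 + (-1) * x)) * f (exp (0 + (-1) * x)))"
    by (rule lborel_integrable_real_affine) simp
  then show "integrable lborel (\<lambda>x. gamma_kernel a x * exp (- (\<i> * of_real x * of_real \<xi>)))"
    by (simp add: k_eq)
  have "(LINT x|lborel. of_real (exp x) * f (exp x)) = (LINT x|lborel. of_real (exp (- x)) * f (exp (- x)))"
    by (subst lborel_integral_real_affine[where c="-1" and t=0]) simp_all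
  then show "(LINT x|lborel. gamma_kernel a x * exp (- (\<i> * of_real x * of_real \<xi>))) = Gamma (of_real a + \<i> * of_real \<xi>)"
    using f_Gamma exp_substitution(2)[OF f_meas f0 f_int] by (simp add: k_eq z_def)
qed

lemma gamma_kernel_integrable: "a > 0 \<Longrightarrow> integrable lborel (gamma_kernel a)"
  using gamma_kernel_has_fourier_integral(1)[of a 0] by simp

lemma conv_flip: "conv f g x = (LINT s|lborel. f s * g (x - s))"
  unfolding conv_def by (subst lborel_integral_real_affine[where c="-1" and t=x]) simp_all

text \<open>The exponential is multiplicative along \<open>t = s + (t - s)\<close>, so it
  distributes over the two factors. The integral of \<open>f\<close> stays unnormalised because for
  \<open>gamma_kernel\<close> it is then exactly a Gamma value.\<close>

lemma fourier_conv:
  assumes f: "integrable lborel f" and g: "integrable lborel g"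
  shows "fourier (conv f g) \<xi> = (LINT x|lborel. f x * exp (- (\<i> * of_real x * of_real \<xi>))) * fourier g \<xi>"
proof -
  let ?e = "\<lambda>x. exp (- (\<i> * complex_of_real x * complex_of_real \<xi>))"
  have e: "?e s * ?e (t - s) = ?e t" for s t
    unfolding mult_exp_exp by (simp add: algebra_simps)
  have "(LINT t|lborel. conv f g t * ?e t) = (LINT t|lborel. LINT s|lborel. (f s * ?e s) * (g (t - s) * ?e (t - s)))"
  proof (rule Bochner_Integration.integral_cong[OF refl])
    fix t
    have "conv f g t * ?e t = (LINT s|lborel. f s * g (t - s) * ?e t)"
      unfolding conv_flip by (rule integral_mult_left_zero[symmetric])
    also have "\<dots> = (LINT s|lborel. (f s * ?e s) * (g (t - s) * ?e (t - s)))"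
    proof (rule Bochner_Integration.integral_cong[OF refl])
      fix s
      show "f s * g (t - s) * ?e t = (f s * ?e s) * (g (t - s) * ?e (t - s))"
        unfolding e[of s t, symmetric] by (simp only: mult_ac)
    qed
    finally show "conv f g t * ?e t = (LINT s|lborel. (f s * ?e s) * (g (t - s) * ?e (t - s)))" .
  qed
  also have "\<dots> = (LINT x|lborel. f x * ?e x) * (LINT x|lborel. g x * ?e x)"
    by (rule convolution_integral(1)[OF integrable_fourier(1)[OF f] integrable_fourier(1)[OF g]])
  finally show ?thesis
    unfolding fourier_def by simp
qed

text \<open>The Gamma factor is replaced by the Fourier integral of its kernel. After exchanging the
  integrals, the inner one is the inversion integral of \<open>u\<close> at
  \<open>x - s\<close>.\<close>

lemma gamma_multiplier_eq_conv:
  assumes u: "u \<in> Z_space" and a: "a > 0"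
  shows "fourier_adj (\<lambda>\<xi>. Gamma (of_real a + \<i> * of_real \<xi>) * fourier u \<xi>) = conv (gamma_kernel a) u"
proof
  fix x
  let ?c = "complex_of_real (1 / sqrt (2 * pi))"
  define p where "p \<xi> = fourier u \<xi> * exp (\<i> * of_real x * of_real \<xi>)" for \<xi>
  have p: "integrable lborel p"
    unfolding p_def by (intro integrable_fourier test_space_integrable fourier_in_test_space u)
  have "fourier_adj (\<lambda>\<xi>. Gamma (of_real a + \<i> * of_real \<xi>) * fourier u \<xi>) x
      = ?c * (LINT \<xi>|lborel. p \<xi> * (LINT s|lborel. gamma_kernel a s * exp (- (\<i> * of_real s * of_real \<xi>))))"
    unfolding fourier_adj_def gamma_kernel_has_fourier_integral(2)[OF a] p_def by (simp only: mult_ac)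
  also have "\<dots> = ?c * (LINT s|lborel. gamma_kernel a s * (LINT \<xi>|lborel. p \<xi> * exp (- (\<i> * of_real s * of_real \<xi>))))"
    by (subst Fubini_bounded_kernel[OF p gamma_kernel_integrable[OF a]]) auto
  also have "\<dots> = (LINT s|lborel. gamma_kernel a s * (?c * (LINT \<xi>|lborel. p \<xi> * exp (- (\<i> * of_real s * of_real \<xi>)))))"
    unfolding integral_mult_right_zero[symmetric] by (simp only: mult_ac)
  also have "\<dots> = (LINT s|lborel. gamma_kernel a s * u (x - s))"
  proof -
    have "?c * (LINT \<xi>|lborel. p \<xi> * exp (- (\<i> * of_real s * of_real \<xi>))) = fourier_adj (fourier u) (x - s)" for s
      unfolding fourier_adj_def p_def mult.assoc[of "fourier u _"] mult_exp_exp by (simp add: algebra_simps)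
    then show ?thesis
      by (simp only: fourier_inversion_Z[OF u])
  qed
  finally show "fourier_adj (\<lambda>\<xi>. Gamma (of_real a + \<i> * of_real \<xi>) * fourier u \<xi>) x = conv (gamma_kernel a) u x"
    by (simp only: conv_flip)
qed

lemma integrable_gamma_kernel_mult:
  assumes "a > 0" "v \<in> borel_measurable borel" "\<And>y. norm (v y) \<le> B"
  shows "integrable lborel (\<lambda>y. gamma_kernel a (x - y) * v y)"
proof (rule integrable_mult_bounded)
  show "integrable lborel (\<lambda>y. gamma_kernel a (x - y))"
    using lborel_integrable_real_affine[OF gamma_kernel_integrable[OF assms(1)], of "-1" x] by simp
qed (use assms in auto)

text \<open>Under \<open>t = exp y\<close> the weight in \<open>v\<close> joins the factor
  \<open>exp (a * y)\<close> of the kernel to form the Jacobian \<open>exp y\<close>. What remains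
  is the Laplace transform of \<open>F\<close> at \<open>exp (- x)\<close>. The cases
  \<open>a = 1 / 2\<close> and \<open>a = 1\<close> serve \<open>f\<close> and its Laplace
  convolution.\<close>

lemma conv_gamma_kernel_eq_laplace:
  assumes F[measurable]: "F \<in> borel_measurable borel" and F0: "\<And>t. t \<le> 0 \<Longrightarrow> F t = 0"
    and v: "\<And>y. v y = of_real (exp ((1 - a) * y)) * F (exp y)"
    and int: "integrable lborel (\<lambda>y. gamma_kernel a (x - y) * v y)"
  shows "integrable lborel (\<lambda>t. of_real (exp (- (exp (- x) * t))) * F t)"
    and "conv (gamma_kernel a) v x = of_real (exp (- (a * x))) * (LINT t|lborel. of_real (exp (- (exp (- x) * t))) * F t)"
proof -
  let ?p = "\<lambda>t. of_real (exp (- (exp (- x) * t))) * F t"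
  have p_meas: "?p \<in> borel_measurable borel" by measurable
  have p0: "t \<le> 0 \<Longrightarrow> ?p t = 0" for t
    using F0 by simp
  have k_eq: "gamma_kernel a (x - y) * v y = of_real (exp (- (a * x))) * (of_real (exp y) * ?p (exp y))" for y
  proof -
    have "exp (- (a * (x - y))) * exp (- exp (- (x - y))) * exp ((1 - a) * y)
        = exp (- (a * x)) * (exp y * exp (- (exp (- x) * exp y)))"
      unfolding mult_exp_exp by (simp add: algebra_simps)
    then show ?thesis
      unfolding gamma_kernel_def v by (simp only: mult.assoc[symmetric] of_real_mult[symmetric])
  qed
  have "integrable lborel (\<lambda>y. of_real (exp (a * x)) * (gamma_kernel a (x - y) * v y))"
    using int by simp
  then have "integrable lborel (\<lambda>y. of_real (exp y) * ?p (exp y))"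
    unfolding k_eq mult.assoc[symmetric] of_real_mult[symmetric] mult_exp_exp by simp
  then show p_int: "integrable lborel ?p"
    using exp_substitution(1)[OF p_meas p0] by blast
  have "conv (gamma_kernel a) v x = of_real (exp (- (a * x))) * (LINT y|lborel. of_real (exp y) * ?p (exp y))"
    unfolding conv_def k_eq by (rule integral_mult_right_zero)
  also have "(LINT y|lborel. of_real (exp y) * ?p (exp y)) = (LINT t|lborel. ?p t)"
    by (rule exp_substitution(2)[OF p_meas p0 p_int, symmetric])
  finally show "conv (gamma_kernel a) v x = of_real (exp (- (a * x))) * (LINT t|lborel. ?p t)" .
qed

subsection \<open>The quadratic forms\<close>

text \<open>In \<open>\<bar>u\<bar>\<^sup>2 = u * cnj u\<close> the second factor is written as an
  inversion integral; after the exchange of integrals the inner one is the transform of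
  \<open>u\<close> at a shifted point. The constant is the one relating \<open>sign_function\<close>
  to \<open>b_function\<close>.\<close>

lemma conv_reflect_fourier:
  assumes u: "u \<in> Z_space"
  shows "conv (reflect (cnj_fun (fourier u))) (fourier u)
    = cscale (of_real (sqrt (2 * pi))) (fourier (\<lambda>x. of_real ((norm (u x))\<^sup>2)))"
proof
  fix \<xi>
  let ?c = "complex_of_real (1 / sqrt (2 * pi))" and ?g = "fourier u"
  let ?e = "\<lambda>x y. exp (- (\<i> * complex_of_real x * complex_of_real y))"
  have g: "integrable lborel ?g"
    by (intro test_space_integrable fourier_in_test_space u)
  have cnj_u: "cnj (u x) = ?c * (LINT \<zeta>|lborel. cnj (?g \<zeta>) * ?e x \<zeta>)" for x
  proof -
    have "cnj (u x) = cnj (fourier_adj ?g x)"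
      by (simp add: fourier_inversion_Z[OF u])
    also have "\<dots> = ?c * cnj (LINT \<zeta>|lborel. ?g \<zeta> * exp (\<i> * of_real x * of_real \<zeta>))"
      by (simp add: fourier_adj_def)
    also have "cnj (LINT \<zeta>|lborel. ?g \<zeta> * exp (\<i> * of_real x * of_real \<zeta>)) = (LINT \<zeta>|lborel. cnj (?g \<zeta>) * ?e x \<zeta>)"
      by (subst Bochner_Integration.integral_cnj[symmetric])
        (simp add: exp_cnj del: Bochner_Integration.integral_cnj)
    finally show ?thesis .
  qed
  have "of_real (sqrt (2 * pi)) * fourier (\<lambda>x. of_real ((norm (u x))\<^sup>2)) \<xi>
      = (LINT x|lborel. of_real ((norm (u x))\<^sup>2) * ?e x \<xi>)"
    by (simp add: fourier_def)
  also have "\<dots> = (LINT x|lborel. ?c * ((u x * ?e x \<xi>) * (LINT \<zeta>|lborel. cnj (?g \<zeta>) * ?e x \<zeta>)))"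
    by (rule Bochner_Integration.integral_cong[OF refl]) (simp only: complex_norm_square cnj_u mult_ac)
  also have "\<dots> = ?c * (LINT x|lborel. (u x * ?e x \<xi>) * (LINT \<zeta>|lborel. cnj (?g \<zeta>) * ?e x \<zeta>))"
    by (rule integral_mult_right_zero)
  also have "\<dots> = ?c * (LINT \<zeta>|lborel. cnj (?g \<zeta>) * (LINT x|lborel. (u x * ?e x \<xi>) * ?e x \<zeta>))"
    using g by (subst Fubini_bounded_kernel[OF integrable_fourier(1)[OF Z_space_integrable[OF u]]]) auto
  also have "\<dots> = (LINT \<zeta>|lborel. cnj (?g \<zeta>) * (?c * (LINT x|lborel. (u x * ?e x \<xi>) * ?e x \<zeta>)))"
    unfolding integral_mult_right_zero[symmetric] by (simp only: mult_ac)
  also have "\<dots> = (LINT \<zeta>|lborel. cnj (?g \<zeta>) * ?g (\<xi> + \<zeta>))"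
  proof -
    have "?c * (LINT x|lborel. (u x * ?e x \<xi>) * ?e x \<zeta>) = ?g (\<xi> + \<zeta>)" for \<zeta>
      unfolding fourier_def mult.assoc[of "u _"] mult_exp_exp by (simp add: algebra_simps)
    then show ?thesis by simp
  qed
  also have "\<dots> = (LINT \<eta>|lborel. cnj (?g (- (\<xi> - \<eta>))) * ?g \<eta>)"
    by (subst (2) lborel_integral_real_affine[where c=1 and t=\<xi>]) simp_all
  finally show "conv (reflect (cnj_fun ?g)) ?g \<xi>
      = cscale (of_real (sqrt (2 * pi))) (fourier (\<lambda>x. of_real ((norm (u x))\<^sup>2))) \<xi>"
    by (simp add: conv_def reflect_def cnj_fun_def cscale_def)
qed

section \<open>Gamma factors as multipliers, and the form of the sign-function\<close>

text \<open>The reciprocal of Gamma is the entire function \<open>rGamma\<close>. At a pole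
  \<open>Gamma\<close> has the default value 0, and so has its inverse, in agreement with
  \<open>rGamma\<close>.\<close>

lemma smooth_inverse_Gamma:
  "smooth (\<lambda>\<xi>. inverse (Gamma (of_real a + \<i> * of_real \<xi>)))"
proof -
  have "(\<lambda>z. rGamma (of_real a + \<i> * z)) holomorphic_on UNIV"
    by (intro holomorphic_intros)
  from smooth_holomorphic(1)[OF this open_UNIV UNIV_I]
  show ?thesis by (simp add: rGamma_inverse_Gamma)
qed

lemma Re_pos_not_nonpos_Int: "Re z > 0 \<Longrightarrow> z \<notin> \<int>\<^sub>\<le>\<^sub>0"
  by (auto elim!: nonpos_Ints_cases')

text \<open>Since \<open>Re (a + \<i> * z) = a - Im z\<close>, the half-plane below height
  \<open>a\<close> avoids all poles and contains the real line.\<close>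

lemma smooth_Gamma:
  assumes "a > 0"
  shows "smooth (\<lambda>\<xi>. Gamma (of_real a + \<i> * of_real \<xi>))"
proof (rule smooth_holomorphic(1)[where E="\<lambda>z. Gamma (of_real a + \<i> * z)"])
  show "open {z. Im z < a}"
    by (rule open_halfspace_Im_lt)
  show "(\<lambda>z. Gamma (of_real a + \<i> * z)) holomorphic_on {z. Im z < a}"
  proof (intro holomorphic_intros)
    show "of_real a + \<i> * z \<notin> \<int>\<^sub>\<le>\<^sub>0" if "z \<in> {z. Im z < a}" for z
      using that by (intro Re_pos_not_nonpos_Int) simp
  qed
qed (use assms in simp)

lemma Gamma_shift_nonzero: "a > 0 \<Longrightarrow> Gamma (complex_of_real a + \<i> * of_real \<xi>) \<noteq> 0"
  by (simp add: Gamma_eq_zero_iff Re_pos_not_nonpos_Int)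

lemma Zp_spaceI: "\<Omega> \<in> Z_space \<Longrightarrow> (\<lambda>t. if 0 < t then \<Omega> (ln t) else 0) \<in> Zp_space"
  by (simp add: Zp_space_def)

text \<open>Serves to pull the constant of \<open>conv_reflect_fourier\<close> out of the form.
  Antilinearity of \<open>h\<close> holds only on \<open>Zp_space\<close>, so membership of the
  argument is checked first.\<close>

lemma b_function_cscale:
  assumes h: "h \<in> dual Zp_space Zp_topology" and G: "G \<in> test_space"
  shows "b_function h (cscale c G) = cnj c * b_function h G"
proof -
  let ?G = "\<lambda>\<xi>. inverse (Gamma (1 + \<i> * of_real \<xi>)) * G \<xi>"
  let ?F = "\<lambda>t. if 0 < t then fourier_adj ?G (ln t) else 0"
  have "?F \<in> Zp_space"
    using smooth_inverse_Gamma[of 1] by (intro Zp_spaceI fourier_adj_in_Z_space test_space_mult G) simp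
  then have "h (cscale c ?F) = cnj c * h ?F"
    using h by (simp add: dual_def antilinear_on_def)
  moreover have "fourier_adj (\<lambda>\<xi>. inverse (Gamma (1 + \<i> * of_real \<xi>)) * cscale c G \<xi>) = cscale c (fourier_adj ?G)"
  proof
    fix x
    have "(LINT \<xi>|lborel. c * (?G \<xi> * exp (\<i> * of_real x * of_real \<xi>)))
        = c * (LINT \<xi>|lborel. ?G \<xi> * exp (\<i> * of_real x * of_real \<xi>))"
      by (rule integral_mult_right_zero)
    then show "fourier_adj (\<lambda>\<xi>. inverse (Gamma (1 + \<i> * of_real \<xi>)) * cscale c G \<xi>) x = cscale c (fourier_adj ?G) x"
      by (simp add: fourier_adj_def cscale_def mult_ac)
  qed
  then have "theta h (fourier_adj (\<lambda>\<xi>. inverse (Gamma (1 + \<i> * of_real \<xi>)) * cscale c G \<xi>)) = h (cscale c ?F)"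
    unfolding theta_def by (intro arg_cong[of _ _ h]) (auto simp: cscale_def)
  ultimately show ?thesis
    by (simp add: b_function_def fourier_distr_def theta_def)
qed

lemma b_form_fourier:
  assumes h: "h \<in> dual Zp_space Zp_topology" and u: "u \<in> Z_space"
  shows "b_form (b_function h) (fourier u) = s_form (sign_function h) u"
  unfolding b_form_def s_form_def sign_function_def conv_reflect_fourier[OF u]
  using b_function_cscale[OF h fourier_in_test_space[OF Z_space_norm_square[OF u]]] by simp

section \<open>The Laplace convolution in the logarithmic variable\<close>

text \<open>The integrand of the Beta integral with both parameters \<open>1 / 2\<close>. The
  exponents come from the factors \<open>exp (- (y / 2))\<close> that relate
  \<open>f (exp y)\<close> to \<open>D_log f y\<close>.\<close>

definition beta_weight :: "real \<Rightarrow> real" where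
  "beta_weight \<sigma> = indicator {0<..<1} \<sigma> * (\<sigma> powr (- 1 / 2) * (1 - \<sigma>) powr (- 1 / 2))"

lemma beta_weight_nonneg: "beta_weight \<sigma> \<ge> 0"
  by (simp add: beta_weight_def)

lemma beta_weight_measurable [measurable]: "beta_weight \<in> borel_measurable borel"
  unfolding beta_weight_def by measurable

lemma integrable_beta_weight: "integrable lborel beta_weight"
proof -
  have eq: "beta_weight = (\<lambda>\<sigma>. indicator {0..1} \<sigma> *\<^sub>R (\<sigma> powr (1 / 2 - 1) * (1 - \<sigma>) powr (1 / 2 - 1)))"
    by (auto simp: fun_eq_iff beta_weight_def indicator_def)
  have "((\<lambda>t::real. t powr (1 / 2 - 1) * (1 - t) powr (1 / 2 - 1)) has_integral Beta (1 / 2) (1 / 2)) {0..1}"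
    by (rule has_integral_Beta_real) auto
  then have "(\<lambda>t::real. t powr (1 / 2 - 1) * (1 - t) powr (1 / 2 - 1)) absolutely_integrable_on {0..1}"
    by (intro nonnegative_absolutely_integrable_1) (auto simp: has_integral_integrable)
  then show ?thesis
    unfolding set_integrable_def eq[symmetric] by (subst (asm) integrable_completion) auto
qed

text \<open>For \<open>u = D_log f\<close> this is the Laplace convolution of the conjugate of
  \<open>f\<close> with \<open>f\<close>, taken at \<open>exp x\<close>. The range of integration no
  longer depends on \<open>x\<close>, which gives boundedness, continuity and integrability from the
  properties of \<open>u\<close>.\<close>

definition log_laplace_conv :: "(real \<Rightarrow> complex) \<Rightarrow> real \<Rightarrow> complex" where
  "log_laplace_conv u x = (LINT \<sigma>|lborel. of_real (beta_weight \<sigma>) * (cnj (u (x + ln \<sigma>)) * u (x + ln (1 - \<sigma>))))"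

lemma borel_measurable_cnj [measurable]: "f \<in> borel_measurable M \<Longrightarrow> (\<lambda>x. cnj (f x)) \<in> borel_measurable M"
  by (rule borel_measurable_continuous_on[where f=cnj]) (auto intro: continuous_intros)

context
  fixes u B
  assumes u: "u \<in> Z_space" and B: "B \<ge> 0" "\<And>x. norm (u x) \<le> B"
begin

lemma log_laplace_conv_integrand_bound:
  "norm (of_real (beta_weight \<sigma>) * (cnj (u (x + ln \<sigma>)) * u (x + ln (1 - \<sigma>)))) \<le> beta_weight \<sigma> * B\<^sup>2"
proof -
  have "norm (u (x + ln \<sigma>)) * norm (u (x + ln (1 - \<sigma>))) \<le> B * B"
    using B by (intro mult_mono) auto
  then show ?thesis
    by (simp add: norm_mult beta_weight_nonneg mult_left_mono power2_eq_square)
qed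

lemma log_laplace_conv_bounded: "norm (log_laplace_conv u x) \<le> (LINT \<sigma>|lborel. beta_weight \<sigma> * B\<^sup>2)"
  unfolding log_laplace_conv_def
proof (rule order_trans[OF integral_norm_bound integral_mono])
  note [measurable] = Z_space_measurable[OF u]
  show *: "integrable lborel (\<lambda>\<sigma>. beta_weight \<sigma> * B\<^sup>2)"
    using integrable_beta_weight by simp
  show "integrable lborel (\<lambda>\<sigma>. norm (of_real (beta_weight \<sigma>) * (cnj (u (x + ln \<sigma>)) * u (x + ln (1 - \<sigma>)))))"
  proof (rule Bochner_Integration.integrable_bound[OF *])
    show "AE \<sigma> in lborel. norm (norm (of_real (beta_weight \<sigma>) * (cnj (u (x + ln \<sigma>)) * u (x + ln (1 - \<sigma>)))))
        \<le> norm (beta_weight \<sigma> * B\<^sup>2)"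
      unfolding real_norm_def abs_norm_cancel
      by (intro AE_I2 order_trans[OF log_laplace_conv_integrand_bound abs_ge_self])
  qed measurable
qed (rule log_laplace_conv_integrand_bound)

lemma log_laplace_conv_continuous: "continuous_on UNIV (log_laplace_conv u)"
  unfolding continuous_on_sequentially
proof (intro allI ballI impI; elim conjE)
  note [measurable] = Z_space_measurable[OF u]
  fix X :: "nat \<Rightarrow> real" and x assume X: "X \<longlonglongrightarrow> x"
  show "(log_laplace_conv u \<circ> X) \<longlonglongrightarrow> log_laplace_conv u x"
    unfolding log_laplace_conv_def o_def
  proof (rule integral_dominated_convergence[where w="\<lambda>\<sigma>. beta_weight \<sigma> * B\<^sup>2"])
    show "integrable lborel (\<lambda>\<sigma>. beta_weight \<sigma> * B\<^sup>2)"
      using integrable_beta_weight by simp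
    have "(\<lambda>k. u (X k + c)) \<longlonglongrightarrow> u (x + c)" for c
      by (rule continuous_on_tendsto_compose[OF Z_space_continuous[OF u, of UNIV]]) (auto intro!: tendsto_intros X)
    then show "AE \<sigma> in lborel. (\<lambda>k. of_real (beta_weight \<sigma>) * (cnj (u (X k + ln \<sigma>)) * u (X k + ln (1 - \<sigma>))))
        \<longlonglongrightarrow> of_real (beta_weight \<sigma>) * (cnj (u (x + ln \<sigma>)) * u (x + ln (1 - \<sigma>)))"
      by (intro AE_I2 tendsto_intros)
    show "AE \<sigma> in lborel. norm (of_real (beta_weight \<sigma>) * (cnj (u (X k + ln \<sigma>)) * u (X k + ln (1 - \<sigma>))))
        \<le> beta_weight \<sigma> * B\<^sup>2" for k
      by (intro AE_I2 log_laplace_conv_integrand_bound)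
  qed measurable
qed

text \<open>One factor is bounded by \<open>B\<close>. The integral of the other over
  \<open>x\<close> is unaffected by the shift \<open>ln \<sigma>\<close>, so only the integral of
  \<open>beta_weight\<close> remains.\<close>

lemma log_laplace_conv_integrable: "integrable lborel (log_laplace_conv u)"
proof -
  note [measurable] = Z_space_measurable[OF u]
  let ?f = "\<lambda>\<sigma> x. of_real (beta_weight \<sigma>) * (cnj (u (x + ln \<sigma>)) * u (x + ln (1 - \<sigma>)))"
  have shift: "integrable lborel (\<lambda>x. norm (u (x + c)))" "(LINT x|lborel. norm (u (x + c))) = (LINT x|lborel. norm (u x))" for c
  proof -
    show "integrable lborel (\<lambda>x. norm (u (x + c)))"
      using lborel_integrable_real_affine[OF integrable_norm[OF Z_space_integrable[OF u]], of 1 c]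
      by (simp add: add.commute)
    show "(LINT x|lborel. norm (u (x + c))) = (LINT x|lborel. norm (u x))"
      by (subst (2) lborel_integral_real_affine[where c=1 and t=c]) (simp_all add: add.commute)
  qed
  have bound: "norm (?f \<sigma> x) \<le> beta_weight \<sigma> * B * norm (u (x + ln \<sigma>))" for \<sigma> x
  proof -
    have "norm (u (x + ln \<sigma>)) * norm (u (x + ln (1 - \<sigma>))) \<le> norm (u (x + ln \<sigma>)) * B"
      using B by (intro mult_left_mono) auto
    then have "beta_weight \<sigma> * (norm (u (x + ln \<sigma>)) * norm (u (x + ln (1 - \<sigma>)))) \<le> beta_weight \<sigma> * (norm (u (x + ln \<sigma>)) * B)"
      by (rule mult_left_mono[OF _ beta_weight_nonneg])
    then show ?thesis
      by (simp add: norm_mult beta_weight_nonneg mult_ac)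
  qed
  have int_x: "integrable lborel (?f \<sigma>)" for \<sigma>
    by (rule Bochner_Integration.integrable_bound[where f="\<lambda>x. beta_weight \<sigma> * B * norm (u (x + ln \<sigma>))"])
      (use shift bound in \<open>auto intro!: AE_I2 intro: order_trans[OF _ abs_ge_self]\<close>)
  have "integrable (lborel \<Otimes>\<^sub>M lborel) (\<lambda>(\<sigma>, x). ?f \<sigma> x)"
  proof (rule lborel_pair.Fubini_integrable)
    show "(\<lambda>(\<sigma>, x). ?f \<sigma> x) \<in> borel_measurable (lborel \<Otimes>\<^sub>M lborel)"
      by measurable
    show "AE \<sigma> in lborel. integrable lborel (\<lambda>x. case (\<sigma>, x) of (\<sigma>, x) \<Rightarrow> ?f \<sigma> x)"
      using int_x by simp
    show "integrable lborel (\<lambda>\<sigma>. LINT x|lborel. norm (case (\<sigma>, x) of (\<sigma>, x) \<Rightarrow> ?f \<sigma> x))"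
    proof (rule Bochner_Integration.integrable_bound)
      show "integrable lborel (\<lambda>\<sigma>. beta_weight \<sigma> * (B * (LINT x|lborel. norm (u x))))"
        by (intro integrable_mult_left integrable_beta_weight)
      show "(\<lambda>\<sigma>. LINT x|lborel. norm (case (\<sigma>, x) of (\<sigma>, x) \<Rightarrow> ?f \<sigma> x)) \<in> borel_measurable lborel"
        by measurable
      have "(LINT x|lborel. norm (?f \<sigma> x)) \<le> beta_weight \<sigma> * (B * (LINT x|lborel. norm (u x)))" for \<sigma>
      proof -
        have "(LINT x|lborel. norm (?f \<sigma> x)) \<le> (LINT x|lborel. beta_weight \<sigma> * B * norm (u (x + ln \<sigma>)))"
          by (intro integral_mono integrable_norm[OF int_x] integrable_mult_right shift bound)
        also have "\<dots> = beta_weight \<sigma> * B * (LINT x|lborel. norm (u x))"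
          unfolding shift(2)[of "ln \<sigma>", symmetric] by (rule integral_mult_right_zero)
        finally show ?thesis by (simp only: mult.assoc)
      qed
      then show "AE \<sigma> in lborel. norm (LINT x|lborel. norm (case (\<sigma>, x) of (\<sigma>, x) \<Rightarrow> ?f \<sigma> x))
          \<le> norm (beta_weight \<sigma> * (B * (LINT x|lborel. norm (u x))))"
        by (intro AE_I2) (auto intro: order_trans[OF _ abs_ge_self])
    qed
  qed
  from lborel_pair.integrable_snd[OF this]
  show ?thesis
    by (simp add: log_laplace_conv_def[abs_def])
qed

end


section \<open>The domain of the form of \<open>h\<close> in the logarithmic variable\<close>

definition D_log :: "(real \<Rightarrow> complex) \<Rightarrow> real \<Rightarrow> complex" where
  "D_log f = (\<lambda>x. of_real (exp (x / 2)) * f (exp x))"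

lemma D_space_D_log: "f \<in> D_space \<Longrightarrow> D_log f \<in> Z_space"
  by (simp add: D_space_def D_log_def)

lemma D_space_nonpos: "f \<in> D_space \<Longrightarrow> t \<le> 0 \<Longrightarrow> f t = 0"
  by (simp add: D_space_def)

lemma D_space_eq:
  assumes "f \<in> D_space"
  shows "f = (\<lambda>t. if 0 < t then of_real (exp (- (ln t / 2))) * D_log f (ln t) else 0)"
  using D_space_nonpos[OF assms]
  by (auto simp: fun_eq_iff D_log_def not_less exp_minus)

lemma D_space_measurable:
  assumes "f \<in> D_space"
  shows "f \<in> borel_measurable borel"
proof -
  note [measurable] = Z_space_measurable[OF D_space_D_log[OF assms]]
  show ?thesis
    by (subst D_space_eq[OF assms]) measurable
qed

text \<open>Extension by zero does the truncation: outside the open interval from 0 to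
  \<open>t\<close> one of the two factors vanishes.\<close>

lemma laplace_conv_eq:
  assumes "f \<in> D_space"
  shows "laplace_conv (cnj_fun f) f t = (LINT s|lborel. cnj (f s) * f (t - s))"
  unfolding laplace_conv_def set_lebesgue_integral_def
  by (rule Bochner_Integration.integral_cong[OF refl])
    (use D_space_nonpos[OF assms] in \<open>auto simp: indicator_def cnj_fun_def not_less\<close>)

lemma laplace_conv_nonpos: "t \<le> 0 \<Longrightarrow> laplace_conv f g t = 0"
  by (simp add: laplace_conv_def set_lebesgue_integral_def)

lemma laplace_conv_exp:
  assumes f: "f \<in> D_space"
  shows "laplace_conv (cnj_fun f) f (exp x) = log_laplace_conv (D_log f) x"
proof -
  have f_exp: "f (exp y) = of_real (exp (- (y / 2))) * D_log f y" for y
    by (simp add: D_log_def exp_minus)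
  \<comment> \<open>The substitution \<open>s = exp x * \<sigma>\<close> moves the integration to
    the fixed interval from 0 to 1.\<close>
  have "laplace_conv (cnj_fun f) f (exp x)
      = (LINT \<sigma>|lborel. of_real (exp x) * (cnj (f (exp x * \<sigma>)) * f (exp x - exp x * \<sigma>)))"
    unfolding laplace_conv_eq[OF f]
    by (subst lborel_integral_real_affine[where c="exp x" and t=0])
      (simp_all add: scaleR_conv_of_real flip: integral_mult_right_zero)
  also have "\<dots> = log_laplace_conv (D_log f) x"
    unfolding log_laplace_conv_def
  proof (rule Bochner_Integration.integral_cong[OF refl])
    fix \<sigma>
    show "of_real (exp x) * (cnj (f (exp x * \<sigma>)) * f (exp x - exp x * \<sigma>))
        = of_real (beta_weight \<sigma>) * (cnj (D_log f (x + ln \<sigma>)) * D_log f (x + ln (1 - \<sigma>)))"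
    proof (cases "0 < \<sigma> \<and> \<sigma> < 1")
      case True
      then have 1: "exp x * \<sigma> = exp (x + ln \<sigma>)" "exp x - exp x * \<sigma> = exp (x + ln (1 - \<sigma>))"
        by (simp_all add: exp_add algebra_simps)
      have "beta_weight \<sigma> = exp (- (ln \<sigma> / 2)) * exp (- (ln (1 - \<sigma>) / 2))"
        using True by (simp add: beta_weight_def powr_def)
      \<comment> \<open>The Jacobian \<open>exp x\<close> cancels the dependence on \<open>x\<close>
        of the two half-power weights.\<close>
      also have "\<dots> = exp x * exp (- ((x + ln \<sigma>) / 2)) * exp (- ((x + ln (1 - \<sigma>)) / 2))"
        unfolding mult_exp_exp by (simp add: field_simps)
      finally show ?thesis
        \<comment> \<open>The second equation is used first, since its left-hand side contains that
          of the first.\<close>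
        unfolding 1(2) unfolding 1(1) f_exp by simp
    next
      case False
      then have "exp x * \<sigma> \<le> 0 \<or> exp x - exp x * \<sigma> \<le> 0"
        by (auto simp: mult_le_0_iff not_less)
      then have "cnj (f (exp x * \<sigma>)) * f (exp x - exp x * \<sigma>) = 0"
        using D_space_nonpos[OF f] by auto
      moreover have "beta_weight \<sigma> = 0"
        using False by (auto simp: beta_weight_def)
      ultimately show ?thesis
        by (simp only: of_real_0 mult_zero_left mult_zero_right)
    qed
  qed
  finally show ?thesis .
qed

text \<open>
  Laplace transforms turn the Laplace convolution into a product. In the variable \<open>x\<close> with
  \<open>\<lambda> = exp (- x)\<close> the Laplace transform is the convolution with a gamma kernel.
\<close>

lemma norm_square_gamma_conv:
  assumes f: "f \<in> D_space"
  shows "of_real ((norm (conv (gamma_kernel (1 / 2)) (D_log f) x))\<^sup>2)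
    = conv (gamma_kernel 1) (log_laplace_conv (D_log f)) x"
proof -
  let ?F = "laplace_conv (cnj_fun f) f" and ?u = "D_log f"
  \<comment> \<open>\<open>f\<close> damped by the Laplace kernel at \<open>exp (- x)\<close>; the
    integral of \<open>p\<close> is the Laplace transform of \<open>f\<close> there.\<close>
  define p where "p t = complex_of_real (exp (- (exp (- x) * t))) * f t" for t
  note u = D_space_D_log[OF f]
  note f_meas [measurable] = D_space_measurable[OF f]
  obtain B where B: "B \<ge> 0" "\<And>y. norm (?u y) \<le> B"
    using Z_space_bounded[OF u] by blast
  \<comment> \<open>The exponent is left as \<open>1 - 1 / 2\<close> to match the weight of
    \<open>conv_gamma_kernel_eq_laplace\<close>; likewise \<open>1 - 1\<close> for the convolution
    further down.\<close>
  have u_eq: "?u y = of_real (exp ((1 - 1 / 2) * y)) * f (exp y)" for y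
    by (simp add: D_log_def)
  have u_int: "integrable lborel (\<lambda>y. gamma_kernel (1 / 2) (x - y) * ?u y)"
    using Z_space_measurable[OF u] B by (intro integrable_gamma_kernel_mult) auto
  note w = conv_gamma_kernel_eq_laplace[where a="1 / 2", OF f_meas D_space_nonpos[OF f] u_eq u_int]
  have p_int: "integrable lborel p"
    using w(1) by (simp add: p_def[abs_def])
  have F_eq: "?F = (\<lambda>t. LINT s|lborel. cnj (f s) * f (t - s))"
    using laplace_conv_eq[OF f] by auto
  have F_meas: "?F \<in> borel_measurable borel"
    unfolding F_eq by measurable
  have \<Omega>_int: "integrable lborel (\<lambda>y. gamma_kernel 1 (x - y) * log_laplace_conv ?u y)"
    by (rule integrable_gamma_kernel_mult[OF _
          borel_measurable_continuous_onI[OF log_laplace_conv_continuous[OF u B]]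
          log_laplace_conv_bounded[OF u B]]) simp
  have \<Omega>_eq: "log_laplace_conv ?u y = of_real (exp ((1 - 1) * y)) * ?F (exp y)" for y
    by (simp add: laplace_conv_exp[OF f])
  have "conv (gamma_kernel 1) (log_laplace_conv ?u) x
      = of_real (exp (- x)) * (LINT t|lborel. of_real (exp (- (exp (- x) * t))) * ?F t)"
    using conv_gamma_kernel_eq_laplace(2)[OF F_meas laplace_conv_nonpos \<Omega>_eq \<Omega>_int] by simp
  also have "(LINT t|lborel. of_real (exp (- (exp (- x) * t))) * ?F t)
      = (LINT t|lborel. LINT s|lborel. cnj (p s) * p (t - s))"
  proof (rule Bochner_Integration.integral_cong[OF refl])
    fix t
    \<comment> \<open>Multiplicativity of the Laplace kernel: the damping at \<open>t\<close> splits
      into dampings at \<open>s\<close> and \<open>t - s\<close>, turning the convolution of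
      \<open>f\<close> into one of \<open>p\<close>.\<close>
    have exp_split: "exp (- (exp (- x) * t)) = exp (- (exp (- x) * s)) * exp (- (exp (- x) * (t - s)))" for s
      unfolding mult_exp_exp by (simp add: algebra_simps)
    have "of_real (exp (- (exp (- x) * t))) * ?F t
        = (LINT s|lborel. of_real (exp (- (exp (- x) * t))) * (cnj (f s) * f (t - s)))"
      unfolding F_eq by (rule integral_mult_right_zero[symmetric])
    also have "\<dots> = (LINT s|lborel. cnj (p s) * p (t - s))"
    proof (rule Bochner_Integration.integral_cong[OF refl])
      fix s
      show "of_real (exp (- (exp (- x) * t))) * (cnj (f s) * f (t - s)) = cnj (p s) * p (t - s)"
        unfolding exp_split[of s] p_def by simp
    qed
    finally show "of_real (exp (- (exp (- x) * t))) * ?F t = (LINT s|lborel. cnj (p s) * p (t - s))" .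
  qed
  also have "\<dots> = cnj (LINT t|lborel. p t) * (LINT t|lborel. p t)"
    using p_int by (subst convolution_integral(1)) auto
  also have "of_real (exp (- x)) * \<dots>
      = cnj (of_real (exp (- (x / 2))) * (LINT t|lborel. p t)) * (of_real (exp (- (x / 2))) * (LINT t|lborel. p t))"
  proof -
    \<comment> \<open>The factor for \<open>a = 1\<close> is shared equally between the two
      conjugate factors, each of which needs the one for \<open>a = 1 / 2\<close>.\<close>
    have "exp (- x) = exp (- (x / 2)) * exp (- (x / 2))"
      unfolding mult_exp_exp by simp
    then show ?thesis by simp
  qed
  also have "of_real (exp (- (x / 2))) * (LINT t|lborel. p t) = conv (gamma_kernel (1 / 2)) ?u x"
    using w(2) by (simp add: p_def)
  finally show ?thesis
    by (simp only: complex_norm_square mult.commute)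
qed

section \<open>The intertwining maps between the domains\<close>

text \<open>The map from \<open>f\<close> to \<open>w\<close>, written as a Fourier multiplier,
  because in this form linearity, injectivity and membership in \<open>Z_space\<close> can be read
  off; the convolution form enters only in the comparison of the forms.\<close>

definition sign_map :: "(real \<Rightarrow> complex) \<Rightarrow> real \<Rightarrow> complex" where
  "sign_map f = fourier_adj (\<lambda>\<xi>. Gamma (of_real (1 / 2) + \<i> * of_real \<xi>) * fourier (D_log f) \<xi>)"

lemma Gamma_fourier_in_test_space:
  "f \<in> D_space \<Longrightarrow> (\<lambda>\<xi>. Gamma (of_real (1 / 2) + \<i> * of_real \<xi>) * fourier (D_log f) \<xi>) \<in> test_space"
  by (intro test_space_mult fourier_in_test_space D_space_D_log smooth_Gamma) auto

lemma sign_map_in_Z_space: "f \<in> D_space \<Longrightarrow> sign_map f \<in> Z_space"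
  unfolding sign_map_def by (intro fourier_adj_in_Z_space Gamma_fourier_in_test_space)

lemma h_form_sign_map:
  assumes f: "f \<in> D_space"
  shows "s_form (sign_function h) (sign_map f) = h_form h f"
proof -
  let ?u = "D_log f" and ?w = "sign_map f"
  let ?\<Omega> = "log_laplace_conv (D_log f)"
  let ?W = "\<lambda>x. complex_of_real ((norm (?w x))\<^sup>2)"
  note u = D_space_D_log[OF f]
  obtain B where B: "B \<ge> 0" "\<And>y. norm (?u y) \<le> B"
    using Z_space_bounded[OF u] by blast
  have "?w = conv (gamma_kernel (1 / 2)) ?u"
    unfolding sign_map_def by (rule gamma_multiplier_eq_conv[OF u]) simp
  then have "?W = conv (gamma_kernel 1) ?\<Omega>"
    using norm_square_gamma_conv[OF f] by auto
  then have "fourier ?W \<xi> = Gamma (1 + \<i> * of_real \<xi>) * fourier ?\<Omega> \<xi>" for \<xi>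
    using fourier_conv[OF gamma_kernel_integrable log_laplace_conv_integrable[OF u B]]
      gamma_kernel_has_fourier_integral(2)[of 1 \<xi>] by simp
  then have mult: "(\<lambda>\<xi>. inverse (Gamma (1 + \<i> * of_real \<xi>)) * fourier ?W \<xi>) = fourier ?\<Omega>"
    using Gamma_shift_nonzero[of 1] by (auto simp: fun_eq_iff)
  have "(\<lambda>\<xi>. inverse (Gamma (1 + \<i> * of_real \<xi>)) * fourier ?W \<xi>) \<in> test_space"
    using smooth_inverse_Gamma[of 1] sign_map_in_Z_space[OF f]
    by (intro test_space_mult fourier_in_test_space Z_space_norm_square) auto
  \<comment> \<open>\<open>?\<Omega>\<close> itself has not been shown to lie in
    \<open>Z_space\<close>. By \<open>mult\<close> its transform is a test function, hence
    integrable, which is what inversion asks for.\<close>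
  then have inv: "fourier_adj (fourier ?\<Omega>) = ?\<Omega>"
    unfolding mult
    by (intro fourier_inversion[OF log_laplace_conv_integrable[OF u B] log_laplace_conv_continuous[OF u B]
          log_laplace_conv_bounded[OF u B]] test_space_integrable)
  \<comment> \<open>The constants \<open>sqrt (2 * pi)\<close> and \<open>1 / sqrt (2 * pi)\<close>
    of the sign-function and the \<open>b\<close>-function cancel.\<close>
  have "s_form (sign_function h) ?w = theta h ?\<Omega>"
    unfolding s_form_def sign_function_def b_function_def fourier_distr_def mult inv by simp
  also have "\<dots> = h_form h f"
    unfolding theta_def h_form_def
    by (rule arg_cong[of _ _ h])
      (auto simp: fun_eq_iff laplace_conv_nonpos not_less laplace_conv_exp[OF f, symmetric])
  finally show ?thesis .
qed

lemma fourier_add: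
  assumes "integrable lborel f" "integrable lborel g"
  shows "fourier (f + g) = fourier f + fourier g"
proof
  fix \<xi>
  show "fourier (f + g) \<xi> = (fourier f + fourier g) \<xi>"
    unfolding fourier_def plus_fun_apply distrib_right distrib_left[symmetric]
    by (simp only: Bochner_Integration.integral_add integrable_fourier assms)
qed

lemma fourier_cscale: "fourier (cscale c f) = cscale c (fourier f)"
  by (simp add: fun_eq_iff fourier_def cscale_def mult.assoc) 

lemma fourier_adj_eq: "fourier_adj f x = fourier f (- x)"
  by (simp add: fourier_def fourier_adj_def mult_ac)

lemma fourier_zero: "fourier 0 = 0" "fourier_adj 0 = 0"
  by (auto simp: fun_eq_iff fourier_def fourier_adj_def)

text \<open>Inverts \<open>sign_map\<close> on the Fourier side: the argument is the transform of an
  element of \<open>Z_space\<close>, so that the map leads from test functions directly to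
  \<open>D_space\<close>.\<close>

definition sign_map_inv :: "(real \<Rightarrow> complex) \<Rightarrow> real \<Rightarrow> complex" where
  "sign_map_inv g t = (if 0 < t then of_real (exp (- (ln t / 2))) *
     fourier_adj (\<lambda>\<xi>. inverse (Gamma (of_real (1 / 2) + \<i> * of_real \<xi>)) * g \<xi>) (ln t) else 0)"

lemma D_log_sign_map_inv:
  "D_log (sign_map_inv g) = fourier_adj (\<lambda>\<xi>. inverse (Gamma (of_real (1 / 2) + \<i> * of_real \<xi>)) * g \<xi>)"
  by (simp add: fun_eq_iff D_log_def sign_map_inv_def exp_minus)

lemma inverse_Gamma_mult_in_test_space:
  "g \<in> test_space \<Longrightarrow> (\<lambda>\<xi>. inverse (Gamma (of_real a + \<i> * of_real \<xi>)) * g \<xi>) \<in> test_space"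
  by (intro test_space_mult smooth_inverse_Gamma)

lemma sign_map_inv_in_D_space:
  assumes "g \<in> test_space"
  shows "sign_map_inv g \<in> D_space"
proof -
  have "D_log (sign_map_inv g) \<in> Z_space"
    unfolding D_log_sign_map_inv by (intro fourier_adj_in_Z_space inverse_Gamma_mult_in_test_space assms)
  then show ?thesis
    by (simp add: D_space_def D_log_def) (simp add: sign_map_inv_def)
qed

lemma sign_map_sign_map_inv:
  assumes "g \<in> test_space"
  shows "sign_map (sign_map_inv g) = fourier_adj g"
  unfolding sign_map_def D_log_sign_map_inv
    fourier_inversion_test[OF inverse_Gamma_mult_in_test_space[OF assms]]
  using Gamma_shift_nonzero[of "1 / 2"] by (simp flip: mult.assoc)

lemma D_log_add: "D_log (f + g) = D_log f + D_log g"
  by (simp add: fun_eq_iff D_log_def algebra_simps)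

lemma D_log_cscale: "D_log (cscale c f) = cscale c (D_log f)"
  by (simp add: fun_eq_iff D_log_def cscale_def)

lemma fourier_adj_add:
  assumes "integrable lborel f" "integrable lborel g"
  shows "fourier_adj (f + g) = fourier_adj f + fourier_adj g"
  using fourier_add[OF assms] by (simp only: fun_eq_iff fourier_adj_eq plus_fun_apply simp_thms)

lemma fourier_adj_cscale: "fourier_adj (cscale c f) = cscale c (fourier_adj f)"
  unfolding fun_eq_iff fourier_adj_eq fourier_cscale by (simp add: cscale_def fourier_adj_eq)

lemma sign_map_add:
  assumes "f \<in> D_space" "g \<in> D_space"
  shows "sign_map (f + g) = sign_map f + sign_map g"
proof -
  let ?\<Gamma> = "\<lambda>\<xi>. Gamma (complex_of_real (1 / 2) + \<i> * of_real \<xi>)"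
  have "(\<lambda>\<xi>. ?\<Gamma> \<xi> * fourier (D_log (f + g)) \<xi>)
      = (\<lambda>\<xi>. ?\<Gamma> \<xi> * fourier (D_log f) \<xi>) + (\<lambda>\<xi>. ?\<Gamma> \<xi> * fourier (D_log g) \<xi>)"
    unfolding D_log_add
      fourier_add[OF Z_space_integrable[OF D_space_D_log[OF assms(1)]] Z_space_integrable[OF D_space_D_log[OF assms(2)]]]
    by (simp add: fun_eq_iff distrib_left)
  then show ?thesis
    unfolding sign_map_def
    using fourier_adj_add[OF test_space_integrable[OF Gamma_fourier_in_test_space[OF assms(1)]]
        test_space_integrable[OF Gamma_fourier_in_test_space[OF assms(2)]]]
    by (simp only:)
qed

lemma sign_map_cscale: "sign_map (cscale c f) = cscale c (sign_map f)"
  unfolding sign_map_def D_log_cscale fourier_cscale fourier_adj_cscale[symmetric]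
  by (simp add: cscale_def mult.left_commute)

text \<open>Both transforms are invertible on the spaces concerned, and the Gamma factor has no
  zeros.\<close>

lemma sign_map_eq_0:
  assumes f: "f \<in> D_space" and 0: "sign_map f = 0"
  shows "f = 0"
proof -
  have "(\<lambda>\<xi>. Gamma (of_real (1 / 2) + \<i> * of_real \<xi>) * fourier (D_log f) \<xi>) = fourier (sign_map f)"
    unfolding sign_map_def by (rule fourier_inversion_test[OF Gamma_fourier_in_test_space[OF f], symmetric])
  also have "\<dots> = 0"
    unfolding 0 by (rule fourier_zero)
  finally have "fourier (D_log f) = 0"
    using Gamma_shift_nonzero[of "1 / 2"] by (simp add: fun_eq_iff)
  then have "D_log f = 0"
    using fourier_inversion_Z[OF D_space_D_log[OF f]] fourier_zero(2) by metis
  then show ?thesis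
    by (subst D_space_eq[OF f]) (simp add: fun_eq_iff)
qed

lemma sign_map_inv_add:
  assumes "g1 \<in> test_space" "g2 \<in> test_space"
  shows "sign_map_inv (g1 + g2) = sign_map_inv g1 + sign_map_inv g2"
proof -
  let ?\<Gamma> = "\<lambda>\<xi>. inverse (Gamma (complex_of_real (1 / 2) + \<i> * of_real \<xi>))"
  have "(\<lambda>\<xi>. ?\<Gamma> \<xi> * (g1 + g2) \<xi>) = (\<lambda>\<xi>. ?\<Gamma> \<xi> * g1 \<xi>) + (\<lambda>\<xi>. ?\<Gamma> \<xi> * g2 \<xi>)"
    by (simp add: fun_eq_iff distrib_left)
  then have "fourier_adj (\<lambda>\<xi>. ?\<Gamma> \<xi> * (g1 + g2) \<xi>)
      = fourier_adj (\<lambda>\<xi>. ?\<Gamma> \<xi> * g1 \<xi>) + fourier_adj (\<lambda>\<xi>. ?\<Gamma> \<xi> * g2 \<xi>)"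
    using fourier_adj_add[OF test_space_integrable[OF inverse_Gamma_mult_in_test_space[OF assms(1)]]
        test_space_integrable[OF inverse_Gamma_mult_in_test_space[OF assms(2)]]]
    by (simp only:)
  then show ?thesis
    unfolding fun_eq_iff sign_map_inv_def plus_fun_apply by (simp only: distrib_left split: if_split) simp
qed

lemma sign_map_inv_cscale: "sign_map_inv (cscale c g) = cscale c (sign_map_inv g)"
proof -
  let ?\<Gamma> = "\<lambda>\<xi>. inverse (Gamma (complex_of_real (1 / 2) + \<i> * of_real \<xi>))"
  have "(\<lambda>\<xi>. ?\<Gamma> \<xi> * cscale c g \<xi>) = cscale c (\<lambda>\<xi>. ?\<Gamma> \<xi> * g \<xi>)"
    by (simp add: fun_eq_iff cscale_def)
  then have "fourier_adj (\<lambda>\<xi>. ?\<Gamma> \<xi> * cscale c g \<xi>) = cscale c (fourier_adj (\<lambda>\<xi>. ?\<Gamma> \<xi> * g \<xi>))"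
    by (simp only: fourier_adj_cscale)
  then show ?thesis
    by (simp add: fun_eq_iff sign_map_inv_def cscale_def)
qed

text \<open>Following it by \<open>sign_map\<close> gives \<open>fourier_adj\<close>, which is
  injective on test functions.\<close>

lemma sign_map_inv_eq_0:
  assumes g: "g \<in> test_space" and 0: "sign_map_inv g = 0"
  shows "g = 0"
proof -
  have "D_log 0 = 0" and "(\<lambda>\<xi>. c \<xi> * 0 \<xi>) = (0 :: real \<Rightarrow> complex)" for c
    by (simp_all add: fun_eq_iff D_log_def)
  then have "sign_map 0 = 0"
    by (simp only: sign_map_def fourier_zero)
  then have "fourier_adj g = 0"
    using sign_map_sign_map_inv[OF g] 0 by simp
  then show ?thesis
    using fourier_inversion_test[OF g] fourier_zero(1) by metis
qed

lemma fourier_eq_0: "u \<in> Z_space \<Longrightarrow> fourier u = 0 \<Longrightarrow> u = 0"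
  using fourier_inversion_Z fourier_zero(2) by metis

text \<open>The function \<open>e\<close> is the identity or the negation, for \<open>N_pos\<close> and \<open>N_neg\<close>.\<close>

lemma N_pos_forms_eq:
  assumes h: "h \<in> dual Zp_space Zp_topology"
  shows "N_pos D_space (\<lambda>f. e (h_form h f)) = N_pos test_space (\<lambda>g. e (b_form (b_function h) g))"
    and "N_pos test_space (\<lambda>g. e (b_form (b_function h) g)) = N_pos Z_space (\<lambda>u. e (s_form (sign_function h) u))"
proof -
  \<comment> \<open>The three inequalities run from \<open>D_space\<close> to
    \<open>Z_space\<close>, on to \<open>test_space\<close> and back to \<open>D_space\<close>, so
    all three numbers coincide.\<close>
  have "N_pos D_space (\<lambda>f. e (h_form h f)) \<le> N_pos Z_space (\<lambda>u. e (s_form (sign_function h) u))"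
    by (rule N_pos_le[where T=sign_map])
      (auto intro: sign_map_in_Z_space sign_map_add sign_map_cscale sign_map_eq_0 simp: h_form_sign_map)
  moreover have "N_pos Z_space (\<lambda>u. e (s_form (sign_function h) u)) \<le> N_pos test_space (\<lambda>g. e (b_form (b_function h) g))"
    by (rule N_pos_le[where T=fourier])
      (auto intro: fourier_in_test_space fourier_add Z_space_integrable fourier_cscale fourier_eq_0
        simp: b_form_fourier[OF h])
  moreover have "N_pos test_space (\<lambda>g. e (b_form (b_function h) g)) \<le> N_pos D_space (\<lambda>f. e (h_form h f))"
  proof (rule N_pos_le[where T=sign_map_inv])
    show "e (h_form h (sign_map_inv g)) = e (b_form (b_function h) g)" if g: "g \<in> test_space" for g
    proof -
      \<comment> \<open>\<open>sign_map\<close> carries \<open>sign_map_inv g\<close> to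
        \<open>fourier_adj g\<close>, and \<open>fourier\<close> carries this to \<open>g\<close>;
        the identities for the other two maps are composed.\<close>
      have "h_form h (sign_map_inv g) = s_form (sign_function h) (fourier_adj g)"
        using h_form_sign_map[OF sign_map_inv_in_D_space[OF g], of h] sign_map_sign_map_inv[OF g] by simp
      also have "\<dots> = b_form (b_function h) g"
        using b_form_fourier[OF h fourier_adj_in_Z_space[OF g]] fourier_inversion_test[OF g] by simp
      finally show ?thesis by simp
    qed
  qed (auto intro: sign_map_inv_in_D_space sign_map_inv_add sign_map_inv_cscale sign_map_inv_eq_0)
  ultimately show "N_pos D_space (\<lambda>f. e (h_form h f)) = N_pos test_space (\<lambda>g. e (b_form (b_function h) g))"
    and "N_pos test_space (\<lambda>g. e (b_form (b_function h) g)) = N_pos Z_space (\<lambda>u. e (s_form (sign_function h) u))"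
    by auto
qed

theorem theorem4p1:
  fixes h b s :: "(real \<Rightarrow> complex) \<Rightarrow> complex"
  assumes "h \<in> dual Zp_space Zp_topology"
    and "real_distr h"
    and "b = b_function h"
    and "s = sign_function h"
  shows "N_pos D_space (h_form h) = N_pos test_space (b_form b)
       \<and> N_pos test_space (b_form b) = N_pos Z_space (s_form s)
       \<and> N_neg D_space (h_form h) = N_neg test_space (b_form b)
       \<and> N_neg test_space (b_form b) = N_neg Z_space (s_form s)"
  using N_pos_forms_eq[OF assms(1), of "\<lambda>z. z"] N_pos_forms_eq[OF assms(1), of uminus]
  unfolding assms(3,4) N_neg_eq_N_pos by simp

end
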